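(* Let $G$ be a locally compact Hausdorff group and $H$ a closed subgroup of $G$, with canonical quotient map $p^{G \to G/H} \colon G \to G/H$. Let $dg$ and $dh$ be left Haar measures of $G$ and $H$, and let $\Delta_G$ and $\Delta_H$ be the modular functions of $G$ and $H$, respectively. Suppose that $\phi \colon G \to \mathbb{C}$ is a continuous function such that the restriction $p^{G \to G/H}|_{\mathrm{supp}(\phi)}$ is proper. Then for every $\nu \in C_c(G)$, $$\int_{G/H} \int_H \nu(gh)\, dh \; d p^{G \to G/H}_*(\phi(g)\, dg) = \int_G \nu(g) \int_H \phi(gh) \frac{\Delta_G(h)}{\Delta_H(h)} \, dh \, dg ,$$ where on the left-hand side $\int_H \nu(gh)\, dh$ is regarded as a function of $gH \in G/H$, integrated against the measure $p^{G \to G/H}_*(\phi(g)\, dg)$ on $G/H$.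
   Context: For a locally compact Hausdorff space $X$, $C_c(X)$ is the space of continuous functions $X \to \mathbb{C}$ with compact support. $C_c(X)^*$ denotes the space of complex Radon measures on $X$, i.e. linear forms on $C_c(X)$ that are continuous for the inductive limit topology (for each compact $K \subset X$ there is $C_K$ with $|\mu(f)| \le C_K \|f\|_\infty$ for all $f \in C_c(X)$ supported in $K$); write $\int_X f \, d\mu := \mu(f)$. The support $\mathrm{supp}(\mu)$ is the complement of the largest open set $U$ such that $\mu(f) = 0$ for all $f \in C_c(X)$ with $\mathrm{supp}(f) \subset U$. A continuous map is proper if the inverse image of every compact set is compact. Pushforward: for a continuous map $p \colon X_1 \to X_2$ of locally compact Hausdorff spaces and $\mu \in C_c(X_1)^*$ such that $p|_{\mathrm{supp}(\mu)}$ is proper, the pushforward $p_*(\mu) \in C_c(X_2)^*$ is defined by $\int_{X_2} \alpha_2 \, dp_*(\mu) := \int_{X_1} \alpha_1 \, d\mu$ for $\alpha_2 \in C_c(X_2)$, where $\alpha_1 \in C_c(X_1)$ is any function with $\alpha_1(x) = \alpha_2(p(x))$ for all $x \in \mathrm{supp}(\mu)$ (such $\alpha_1$ exists and the value does not depend on its choice). The measure $\phi(g)\,dg$ satisfies $\mathrm{supp}(\phi(g)\,dg) = \mathrm{supp}(\phi)$, so its pushforward under $p^{G \to G/H}$ is defined. Modular function convention: $\Delta_G \colon G \to \mathbb{R}_{>0}$ is the continuous homomorphism with $\int_G f(g x)\, dg = \Delta_G(x)^{-1} \int_G f(g)\, dg$ for all $f \in C_c(G)$ and $x \in G$, where $dg$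 is a left Haar measure; similarly for $\Delta_H$. *)

theory Defs
  imports "HOL-Analysis.Analysis" "HOL-Algebra.Left_Coset"
begin

locale locally_compact_group = group G for G (structure) and T :: "'a topology" +
  assumes topspace_eq_carrier: "topspace T = carrier G"
    and continuous_mult: "continuous_map (prod_topology T T) T (\<lambda>(x, y). x \<otimes> y)"
    and continuous_inv: "continuous_map T T (\<lambda>x. inv x)"
    and Hausdorff: "Hausdorff_space T"
    and locally_compact: "locally_compact_space T"

definition fun_supp :: "'a topology \<Rightarrow> ('a \<Rightarrow> complex) \<Rightarrow> 'a set" where
  "fun_supp X f = X closure_of {x \<in> topspace X. f x \<noteq> 0}"

text \<open>Functions are total on the ambient type; their values off \<open>topspace X\<close> are unconstrained.\<close>

definition Cc :: "'a topology \<Rightarrow> ('a \<Rightarrow> complex) set" where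
  "Cc X = {f. continuous_map X euclidean f \<and> compactin X (fun_supp X f)}"

text \<open>Including \<open>0\<close> only matters for an empty space.\<close>

definition sup_norm :: "'a topology \<Rightarrow> ('a \<Rightarrow> complex) \<Rightarrow> real" where
  "sup_norm X f = Sup (insert 0 ((\<lambda>x. cmod (f x)) ` topspace X))"

text \<open>
  A complex Radon measure \<open>\<mu>\<close> is a linear form on \<open>Cc X\<close>, and \<open>\<mu> f\<close> is the integral of \<open>f\<close>.
  The norm bound makes \<open>\<mu> f\<close> independent of the values of \<open>f\<close> off \<open>topspace X\<close>, so \<open>\<mu>\<close> is indeed
  a form on the functions with domain \<open>topspace X\<close>. The values of \<open>\<mu>\<close> outside \<open>Cc X\<close> carry no meaning.
\<close>

definition radon_measure :: "'a topology \<Rightarrow> (('a \<Rightarrow> complex) \<Rightarrow> complex) \<Rightarrow> bool" where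
  "radon_measure X \<mu> \<longleftrightarrow>
     (\<forall>f\<in>Cc X. \<forall>g\<in>Cc X. \<mu> (\<lambda>x. f x + g x) = \<mu> f + \<mu> g) \<and>
     (\<forall>c. \<forall>f\<in>Cc X. \<mu> (\<lambda>x. c * f x) = c * \<mu> f) \<and>
     (\<forall>K. compactin X K \<longrightarrow>
        (\<exists>C. \<forall>f\<in>Cc X. fun_supp X f \<subseteq> K \<longrightarrow> cmod (\<mu> f) \<le> C * sup_norm X f))"

definition measure_supp :: "'a topology \<Rightarrow> (('a \<Rightarrow> complex) \<Rightarrow> complex) \<Rightarrow> 'a set" where
  "measure_supp X \<mu> =
     topspace X - (GREATEST U. openin X U \<and> (\<forall>f\<in>Cc X. fun_supp X f \<subseteq> U \<longrightarrow> \<mu> f = 0))"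

text \<open>The measure \<open>\<phi> d\<mu>\<close>.\<close>

definition density_measure ::
  "('a \<Rightarrow> complex) \<Rightarrow> (('a \<Rightarrow> complex) \<Rightarrow> complex) \<Rightarrow> ('a \<Rightarrow> complex) \<Rightarrow> complex" where
  "density_measure \<phi> \<mu> = (\<lambda>f. \<mu> (\<lambda>x. \<phi> x * f x))"

text \<open>
  The library's \<^const>\<open>proper_map\<close> (closed with compact fibres) is a different definition, which agrees
  with this one for continuous maps into locally compact Hausdorff spaces.
\<close>

definition proper_continuous_map :: "'a topology \<Rightarrow> 'b topology \<Rightarrow> ('a \<Rightarrow> 'b) \<Rightarrow> bool" where
  "proper_continuous_map X Y p \<longleftrightarrow>
     continuous_map X Y p \<and> (\<forall>K. compactin Y K \<longrightarrow> compactin X {x \<in> topspace X. p x \<in> K})"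

text \<open>Meaningful when \<open>p\<close> is continuous and proper on \<open>measure_supp X \<mu>\<close>, for arguments in \<open>Cc Y\<close>.\<close>

definition pushforward ::
  "'a topology \<Rightarrow> ('a \<Rightarrow> 'b) \<Rightarrow> (('a \<Rightarrow> complex) \<Rightarrow> complex) \<Rightarrow> ('b \<Rightarrow> complex) \<Rightarrow> complex" where
  "pushforward X p \<mu> =
     (\<lambda>\<beta>. \<mu> (SOME \<alpha>. \<alpha> \<in> Cc X \<and> (\<forall>x\<in>measure_supp X \<mu>. \<alpha> x = \<beta> (p x))))"

definition left_haar_measure ::
  "('a, 'm) monoid_scheme \<Rightarrow> 'a topology \<Rightarrow> (('a \<Rightarrow> complex) \<Rightarrow> complex) \<Rightarrow> bool" where
  "left_haar_measure G T \<mu> \<longleftrightarrow>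
     radon_measure T \<mu> \<and>
     (\<forall>f\<in>Cc T. (\<forall>x\<in>topspace T. f x \<in> \<real>\<^sub>\<ge>\<^sub>0) \<longrightarrow> \<mu> f \<in> \<real>\<^sub>\<ge>\<^sub>0) \<and>
     (\<exists>f\<in>Cc T. \<mu> f \<noteq> 0) \<and>
     (\<forall>f\<in>Cc T. \<forall>x\<in>carrier G. \<mu> (\<lambda>g. f (x \<otimes>\<^bsub>G\<^esub> g)) = \<mu> f)"

text \<open>
  Here \<open>\<mu>\<close> is a left Haar measure. Note the convention: the factor is \<open>\<Delta> x\<close> to the power \<open>-1\<close>.
\<close>

definition modular_function ::
  "('a, 'm) monoid_scheme \<Rightarrow> 'a topology \<Rightarrow> (('a \<Rightarrow> complex) \<Rightarrow> complex) \<Rightarrow> ('a \<Rightarrow> real) \<Rightarrow> bool" where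
  "modular_function G T \<mu> \<Delta> \<longleftrightarrow>
     continuous_map T euclidean \<Delta> \<and>
     (\<forall>x\<in>carrier G. \<Delta> x > 0) \<and>
     (\<forall>x\<in>carrier G. \<forall>y\<in>carrier G. \<Delta> (x \<otimes>\<^bsub>G\<^esub> y) = \<Delta> x * \<Delta> y) \<and>
     (\<forall>f\<in>Cc T. \<forall>x\<in>carrier G. \<mu> (\<lambda>g. f (g \<otimes>\<^bsub>G\<^esub> x)) = complex_of_real (inverse (\<Delta> x)) * \<mu> f)"

definition coset_topology :: "('a, 'm) monoid_scheme \<Rightarrow> 'a topology \<Rightarrow> 'a set \<Rightarrow> 'a set topology" where
  "coset_topology G T H =
     topology (\<lambda>U. U \<subseteq> lcosets\<^bsub>G\<^esub> H \<and> openin T {g \<in> topspace T. g <#\<^bsub>G\<^esub> H \<in> U})"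

lemma openin_coset_topology:
  "openin (coset_topology G T H) U \<longleftrightarrow>
     U \<subseteq> lcosets\<^bsub>G\<^esub> H \<and> openin T {g \<in> topspace T. g <#\<^bsub>G\<^esub> H \<in> U}"
proof -
  let ?P = "\<lambda>U. {g \<in> topspace T. g <#\<^bsub>G\<^esub> H \<in> U}"
  have "istopology (\<lambda>U. U \<subseteq> lcosets\<^bsub>G\<^esub> H \<and> openin T (?P U))"
    unfolding istopology_def
  proof (intro conjI allI impI)
    fix S R assume "S \<subseteq> lcosets\<^bsub>G\<^esub> H \<and> openin T (?P S)" "R \<subseteq> lcosets\<^bsub>G\<^esub> H \<and> openin T (?P R)"
    moreover have "?P (S \<inter> R) = ?P S \<inter> ?P R" by auto
    ultimately show "S \<inter> R \<subseteq> lcosets\<^bsub>G\<^esub> H" "openin T (?P (S \<inter> R))" by auto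
  next
    fix \<K> assume K: "\<forall>K\<in>\<K>. K \<subseteq> lcosets\<^bsub>G\<^esub> H \<and> openin T (?P K)"
    have "?P (\<Union>\<K>) = (\<Union>K\<in>\<K>. ?P K)" by auto
    with K show "\<Union>\<K> \<subseteq> lcosets\<^bsub>G\<^esub> H" "openin T (?P (\<Union>\<K>))" by auto
  qed
  then show ?thesis
    by (simp add: coset_topology_def topology_inverse')
qed

lemma quotient_map_coset_topology:
  assumes "topspace T = carrier G"
  shows "quotient_map T (coset_topology G T H) (\<lambda>g. g <#\<^bsub>G\<^esub> H)"
proof -
  have *: "{g \<in> carrier G. g <#\<^bsub>G\<^esub> H \<in> lcosets\<^bsub>G\<^esub> H} = topspace T"
    using assms by (auto simp: LCOSETS_def)
  have "openin (coset_topology G T H) (lcosets\<^bsub>G\<^esub> H)"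
    unfolding openin_coset_topology assms * by (simp add: assms[symmetric])
  then have top: "topspace (coset_topology G T H) = lcosets\<^bsub>G\<^esub> H"
    by (metis openin_coset_topology openin_subset openin_topspace subset_antisym)
  then show ?thesis
    unfolding quotient_map_def by (auto simp: openin_coset_topology assms LCOSETS_def)
qed

text \<open>
  The function \<open>gH \<mapsto> F g\<close> on the left cosets, for \<open>F\<close> constant on each left coset of \<open>H\<close>.
\<close>

definition on_cosets ::
  "('a, 'm) monoid_scheme \<Rightarrow> 'a set \<Rightarrow> ('a \<Rightarrow> complex) \<Rightarrow> 'a set \<Rightarrow> complex" where
  "on_cosets G H F = (\<lambda>C. F (SOME g. g \<in> carrier G \<and> g <#\<^bsub>G\<^esub> H = C))"

end

theory Submission
  imports Defs
begin

text \<open>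
  For \<open>\<phi>\<close> of compact support, Fubini's theorem on \<open>G \<times> H\<close> turns \<open>\<integral>\<integral> \<phi> g * \<nu> (g h) dh dg\<close> into an
  integral over \<open>h\<close> of integrals over \<open>g\<close>; the substitution \<open>g \<mapsto> g h\<^sup>-\<^sup>1\<close> produces \<open>\<Delta>\<^sub>G(h)\<^sup>-\<^sup>1\<close>, and
  after a second use of Fubini's theorem the substitution \<open>h \<mapsto> h\<^sup>-\<^sup>1\<close> in \<open>H\<close> produces \<open>\<Delta>\<^sub>H(h)\<^sup>-\<^sup>1\<close>.
  In general, only the values of \<open>\<phi>\<close> on \<open>K = {g \<in> supp \<phi>. gH meets supp \<nu>}\<close> matter. This set is compact
  because the quotient map is proper on \<open>supp \<phi>\<close>, so \<open>\<phi>\<close> can be multiplied by a function in \<open>C\<^sub>c(G)\<close>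
  that equals \<open>1\<close> on \<open>K\<close>.
\<close>

section \<open>Compactly supported functions and Radon measures\<close>

text \<open>The pushforward refers to the support of \<open>density_measure \<phi> dg\<close> as a
  measure, while properness is assumed on the support of \<phi> as a function. Identifying the two
  requires that the Haar integral of a nonnegative, not identically zero function is nonzero; here
  the positivity and nontriviality of \<open>dg\<close> enter. The obstacle on the right is that
  \<phi> itself is not compactly supported, so integrals cannot be interchanged directly. One cutoff
  repairs both sides: on \<open>supp \<phi>\<close> the inner integral of \<nu> vanishes outside the
  compact set, and \<nu>(g) \<phi>(gh) can be nonzero only if gh lies in it. The inversion h to h^-1
  also turns the factor \<open>inverse (\<Delta>\<^sub>G h)\<close> into
  \<open>\<Delta>\<^sub>G h\<close>, which is why the final weight is the quotient of the modular
  functions. The inversion formula is derived without uniqueness of Haar measure, by pairing with an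
  auxiliary function of nonzero integral.\<close>

lemma continuous_map_mult:
  fixes f g :: "'a \<Rightarrow> 'b::real_normed_algebra"
  assumes "continuous_map X euclidean f" "continuous_map X euclidean g"
  shows "continuous_map X euclidean (\<lambda>x. f x * g x)"
  using assms by (simp add: continuous_map_atin tendsto_mult)

lemma continuous_map_of_real:
  fixes f :: "'a \<Rightarrow> real"
  assumes "continuous_map X euclidean f"
  shows "continuous_map X euclidean (\<lambda>x. of_real (f x) :: 'b::real_normed_algebra_1)"
  using assms by (simp add: continuous_map_atin tendsto_of_real)

lemma continuous_map_compose':
  assumes "continuous_map Y Z g" "continuous_map X Y f"
  shows "continuous_map X Z (\<lambda>x. g (f x))"
  using continuous_map_compose[OF assms(2,1)] by (simp add: o_def)

lemma fun_supp_subset: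
  assumes "closedin X K" "\<And>x. x \<in> topspace X \<Longrightarrow> f x \<noteq> 0 \<Longrightarrow> x \<in> K"
  shows "fun_supp X f \<subseteq> K"
  unfolding fun_supp_def using assms by (intro closure_of_minimal) auto

lemma in_fun_supp: "x \<in> topspace X \<Longrightarrow> f x \<noteq> 0 \<Longrightarrow> x \<in> fun_supp X f"
  unfolding fun_supp_def by (auto intro!: closure_of_subset[THEN subsetD])

text \<open>Compact sets are closed in a Hausdorff space, so \<open>K\<close> contains the closure
  of the nonzero set. Supports therefore never have to be computed exactly.\<close>

lemma CcI:
  assumes "Hausdorff_space X" "continuous_map X euclidean f" "compactin X K"
    "\<And>x. x \<in> topspace X \<Longrightarrow> f x \<noteq> 0 \<Longrightarrow> x \<in> K"
  shows "f \<in> Cc X"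
proof -
  have "closedin X K" using assms compactin_imp_closedin by blast
  then have "fun_supp X f \<subseteq> K" using assms by (intro fun_supp_subset)
  then have "compactin X (fun_supp X f)"
    using closed_compactin[OF assms(3)] by (simp add: fun_supp_def)
  then show ?thesis using assms by (simp add: Cc_def)
qed

lemma CcD:
  assumes "f \<in> Cc X"
  shows "continuous_map X euclidean f" "compactin X (fun_supp X f)"
  using assms by (auto simp: Cc_def)

lemma Cc_cong:
  assumes "f \<in> Cc X" "\<And>x. x \<in> topspace X \<Longrightarrow> f x = g x"
  shows "g \<in> Cc X"
proof -
  have "fun_supp X f = fun_supp X g"
    unfolding fun_supp_def using assms(2) by (intro arg_cong[where f = "(closure_of) X"]) auto
  then show ?thesis
    using assms continuous_map_eq[of X euclidean f g] by (auto simp: Cc_def)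
qed

lemma Cc_mult_left:
  assumes "Hausdorff_space X" "continuous_map X euclidean g" "f \<in> Cc X"
  shows "(\<lambda>x. g x * f x) \<in> Cc X"
  using assms CcD[OF assms(3)]
  by (intro CcI[where K = "fun_supp X f"] continuous_map_mult) (auto intro: in_fun_supp)

lemma Cc_mult_right:
  assumes "Hausdorff_space X" "continuous_map X euclidean g" "f \<in> Cc X"
  shows "(\<lambda>x. f x * g x) \<in> Cc X"
  using Cc_mult_left[OF assms] by (simp add: mult.commute)

lemma Cc_add:
  assumes "Hausdorff_space X" "f \<in> Cc X" "g \<in> Cc X"
  shows "(\<lambda>x. f x + g x) \<in> Cc X"
proof (rule CcI[OF assms(1)])
  show "compactin X (fun_supp X f \<union> fun_supp X g)"
    using CcD[OF assms(2)] CcD[OF assms(3)] by (simp add: compactin_Un)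
  show "x \<in> fun_supp X f \<union> fun_supp X g" if "x \<in> topspace X" "f x + g x \<noteq> 0" for x
    using in_fun_supp[of x X f] in_fun_supp[of x X g] that by (cases "g x = 0") auto
qed (use CcD[OF assms(2)] CcD[OF assms(3)] in \<open>simp add: continuous_map_add\<close>)

lemma Cc_cmult:
  assumes "Hausdorff_space X" "f \<in> Cc X"
  shows "(\<lambda>x. c * f x) \<in> Cc X"
  using Cc_mult_left[OF assms(1) _ assms(2), of "\<lambda>_. c"] by simp

lemma Cc_multc:
  assumes "Hausdorff_space X" "f \<in> Cc X"
  shows "(\<lambda>x. f x * c) \<in> Cc X"
  using Cc_cmult[OF assms] by (simp add: mult.commute)

lemma Cc_diff:
  assumes "Hausdorff_space X" "f \<in> Cc X" "g \<in> Cc X"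
  shows "(\<lambda>x. f x - g x) \<in> Cc X"
  using Cc_add[OF assms(1,2) Cc_cmult[OF assms(1,3), of "-1"]] by simp

lemma Cc_zero: "Hausdorff_space X \<Longrightarrow> (\<lambda>x. 0) \<in> Cc X"
  by (rule CcI[where K = "{}"]) auto

lemma Cc_sum:
  assumes "Hausdorff_space X" "\<And>i. i \<in> I \<Longrightarrow> f i \<in> Cc X"
  shows "(\<lambda>x. \<Sum>i\<in>I. f i x) \<in> Cc X"
  using assms(2)
  by (induction I rule: infinite_finite_induct)
     (auto simp: Cc_zero assms(1) intro!: Cc_add assms(1))

lemma radon_add:
  "radon_measure X \<mu> \<Longrightarrow> f \<in> Cc X \<Longrightarrow> g \<in> Cc X \<Longrightarrow> \<mu> (\<lambda>x. f x + g x) = \<mu> f + \<mu> g"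
  by (simp add: radon_measure_def)

lemma radon_cmult:
  "radon_measure X \<mu> \<Longrightarrow> f \<in> Cc X \<Longrightarrow> \<mu> (\<lambda>x. c * f x) = c * \<mu> f"
  by (simp add: radon_measure_def)

lemma radon_multc:
  "radon_measure X \<mu> \<Longrightarrow> f \<in> Cc X \<Longrightarrow> \<mu> (\<lambda>x. f x * c) = \<mu> f * c"
  by (simp add: radon_measure_def mult.commute)

lemma radon_zero: "Hausdorff_space X \<Longrightarrow> radon_measure X \<mu> \<Longrightarrow> \<mu> (\<lambda>x. 0) = 0"
  using radon_cmult[of X \<mu> "\<lambda>x. 0" 0] Cc_zero by auto

lemma radon_diff:
  assumes "Hausdorff_space X" "radon_measure X \<mu>" "f \<in> Cc X" "g \<in> Cc X"
  shows "\<mu> (\<lambda>x. f x - g x) = \<mu> f - \<mu> g"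
  using radon_add[OF assms(2,3) Cc_cmult[OF assms(1,4), of "-1"]]
    radon_cmult[OF assms(2,4), of "-1"] by simp

lemma radon_sum:
  assumes "Hausdorff_space X" "radon_measure X \<mu>" "\<And>i. i \<in> I \<Longrightarrow> f i \<in> Cc X"
  shows "\<mu> (\<lambda>x. \<Sum>i\<in>I. f i x) = (\<Sum>i\<in>I. \<mu> (f i))"
  using assms(3)
  by (induction I rule: infinite_finite_induct)
     (auto simp: radon_zero[OF assms(1,2)] radon_add[OF assms(2) _ Cc_sum[OF assms(1)]])

text \<open>The continuity condition in usable form: any pointwise bound \<open>e\<close> replaces
  the supremum, and vanishing off \<open>K\<close> replaces the inclusion of supports.\<close>

lemma radon_bound:
  assumes "Hausdorff_space X" "radon_measure X \<mu>" "compactin X K"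
  shows "\<exists>C\<ge>0. \<forall>f\<in>Cc X. \<forall>e\<ge>0. (\<forall>x\<in>topspace X. f x \<noteq> 0 \<longrightarrow> x \<in> K) \<longrightarrow>
    (\<forall>x\<in>topspace X. cmod (f x) \<le> e) \<longrightarrow> cmod (\<mu> f) \<le> C * e"
proof -
  obtain C where C: "\<And>f. f \<in> Cc X \<Longrightarrow> fun_supp X f \<subseteq> K \<Longrightarrow> cmod (\<mu> f) \<le> C * sup_norm X f"
    using assms unfolding radon_measure_def by meson
  show ?thesis
  \<comment> \<open>The given \<open>C\<close> may be negative; the absolute value makes the bound
    monotone in the norm.\<close>
  proof (intro exI[of _ "\<bar>C\<bar>"] conjI ballI allI impI)
    fix f and e :: real
    assume f: "f \<in> Cc X" "e \<ge> 0" "\<forall>x\<in>topspace X. f x \<noteq> 0 \<longrightarrow> x \<in> K"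
      "\<forall>x\<in>topspace X. cmod (f x) \<le> e"
    have "fun_supp X f \<subseteq> K"
      using f assms by (intro fun_supp_subset compactin_imp_closedin) auto
    then have "cmod (\<mu> f) \<le> C * sup_norm X f" using C f by blast
    moreover have "sup_norm X f \<le> e"
      unfolding sup_norm_def using f by (intro cSup_least) auto
    moreover have "sup_norm X f \<ge> 0"
      unfolding sup_norm_def using f by (intro cSup_upper bdd_aboveI[of _ e]) auto
    ultimately show "cmod (\<mu> f) \<le> \<bar>C\<bar> * e"
      by (smt (verit) abs_ge_self mult_mono)
  qed auto
qed

text \<open>The difference has empty support and sup norm 0, so the continuity bound for the compact
  set \<open>{}\<close> with \<open>e = 0\<close> kills its integral. This makes the arbitrary
  values off the space harmless.\<close>

lemma radon_cong:
  assumes "Hausdorff_space X" "radon_measure X \<mu>" "f \<in> Cc X"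
    "\<And>x. x \<in> topspace X \<Longrightarrow> f x = g x"
  shows "\<mu> f = \<mu> g"
proof -
  have g: "g \<in> Cc X" using Cc_cong assms by blast
  obtain C where "\<forall>f\<in>Cc X. \<forall>e\<ge>0. (\<forall>x\<in>topspace X. f x \<noteq> 0 \<longrightarrow> x \<in> {}) \<longrightarrow>
    (\<forall>x\<in>topspace X. cmod (f x) \<le> e) \<longrightarrow> cmod (\<mu> f) \<le> C * e"
    using radon_bound[OF assms(1,2) compactin_empty] by blast
  from this[rule_format, of "\<lambda>x. f x - g x" 0] have "cmod (\<mu> (\<lambda>x. f x - g x)) \<le> 0"
    using assms g Cc_diff by auto
  then show ?thesis using radon_diff[OF assms(1-3) g] by simp
qed

section \<open>Partitions of unity\<close>

text \<open>Local compactness gives an open \<open>V\<close> and a compact \<open>C\<close> with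
  \<open>x \<in> V \<subseteq> C \<subseteq> U\<close>; complete regularity gives a function that is
  1 at \<open>x\<close> and 0 off \<open>V\<close>, whose absolute value is taken.\<close>

lemma bump_function:
  assumes "Hausdorff_space X" "locally_compact_space X" "openin X U" "x \<in> U"
  obtains b :: "'a \<Rightarrow> real" and C where "continuous_map X euclidean b" "\<And>y. b y \<ge> 0" "b x = 1"
    "compactin X C" "C \<subseteq> U" "\<And>y. y \<in> topspace X \<Longrightarrow> b y \<noteq> 0 \<Longrightarrow> y \<in> C"
proof -
  have reg: "completely_regular_space X"
    using assms locally_compact_Hausdorff_imp_regular_space
      locally_compact_regular_imp_completely_regular_space by blast
  have "neighbourhood_base_of (compactin X) X"
    using assms locally_compact_space_neighbourhood_base by blast
  then obtain V C where VC: "openin X V" "compactin X C" "x \<in> V" "V \<subseteq> C" "C \<subseteq> U"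
    unfolding neighbourhood_base_of using assms by meson
  obtain f :: "'a \<Rightarrow> real" where f: "continuous_map X euclidean f" "f x = 1"
    "f ` (topspace X - V) \<subseteq> {0}"
    using reg[unfolded completely_regular_space_gen_alt'[OF one_neq_zero]] VC by metis
  show thesis
  proof (rule that[of "\<lambda>y. \<bar>f y\<bar>" C])
    show "continuous_map X euclidean (\<lambda>y. \<bar>f y\<bar>)"
      using f by (intro continuous_map_real_abs)
  qed (use f VC in auto)
qed

text \<open>The index set consists of points of \<open>K\<close>, so an index can serve later as a
  sample point of a kernel or as the centre of a translate.\<close>

lemma partition_of_unity:
  assumes X: "Hausdorff_space X" "locally_compact_space X" and K: "compactin X K"
    and U: "\<And>x. x \<in> K \<Longrightarrow> openin X (U x)" "\<And>x. x \<in> K \<Longrightarrow> x \<in> U x"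
  obtains I and u :: "'a \<Rightarrow> 'a \<Rightarrow> real" and C where "finite I" "I \<subseteq> K"
    "\<And>i. i \<in> I \<Longrightarrow> continuous_map X euclidean (u i)"
    "\<And>i. i \<in> I \<Longrightarrow> compactin X (C i)" "\<And>i. i \<in> I \<Longrightarrow> C i \<subseteq> U i"
    "\<And>i x. i \<in> I \<Longrightarrow> x \<in> topspace X \<Longrightarrow> u i x \<noteq> 0 \<Longrightarrow> x \<in> C i"
    "\<And>i x. i \<in> I \<Longrightarrow> u i x \<ge> 0"
    "\<And>x. (\<Sum>i\<in>I. u i x) \<le> 1"
    "\<And>x. x \<in> K \<Longrightarrow> (\<Sum>i\<in>I. u i x) = 1"
proof -
  have "\<forall>x\<in>K. \<exists>b C. continuous_map X euclideanreal b \<and> (\<forall>y. b y \<ge> 0) \<and> b x = 1 \<and>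
    compactin X C \<and> C \<subseteq> U x \<and> (\<forall>y\<in>topspace X. b y \<noteq> 0 \<longrightarrow> y \<in> C)"
    using bump_function[OF X U] by metis
  then obtain b :: "'a \<Rightarrow> 'a \<Rightarrow> real" and C where
    "\<forall>x\<in>K. continuous_map X euclideanreal (b x) \<and> (\<forall>y. b x y \<ge> 0) \<and> b x x = 1 \<and>
    compactin X (C x) \<and> C x \<subseteq> U x \<and> (\<forall>y\<in>topspace X. b x y \<noteq> 0 \<longrightarrow> y \<in> C x)"
    unfolding bchoice_iff by blast
  then have b:
    "\<And>x. x \<in> K \<Longrightarrow> continuous_map X euclidean (b x)" "\<And>x y. x \<in> K \<Longrightarrow> b x y \<ge> 0"
    "\<And>x. x \<in> K \<Longrightarrow> b x x = 1" "\<And>x. x \<in> K \<Longrightarrow> compactin X (C x)" "\<And>x. x \<in> K \<Longrightarrow> C x \<subseteq> U x"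
    "\<And>x y. x \<in> K \<Longrightarrow> y \<in> topspace X \<Longrightarrow> b x y \<noteq> 0 \<Longrightarrow> y \<in> C x"
    by auto
  \<comment> \<open>Any threshold below \<open>b x x = 1\<close> works here; the same 1/2 must
    reappear in the denominator of \<open>u\<close>.\<close>
  define N where "N x = {y \<in> topspace X. b x y \<in> {1/2<..}}" for x
  have "openin X (N x)" if "x \<in> K" for x
    unfolding N_def using b(1)[OF that] by (rule openin_continuous_map_preimage) auto
  moreover have "K \<subseteq> \<Union> (N ` K)"
    using compactin_subset_topspace[OF K] b(3) by (force simp: N_def)
  ultimately obtain \<F> where "finite \<F>" "\<F> \<subseteq> N ` K" "K \<subseteq> \<Union>\<F>"
    using K unfolding compactin_def by (metis (no_types, lifting) imageE)
  then obtain I where I: "finite I" "I \<subseteq> K" "K \<subseteq> \<Union> (N ` I)"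
    by (metis finite_subset_image)
  define s where "s y = (\<Sum>i\<in>I. b i y)" for y
  have s: "continuous_map X euclidean s"
    unfolding s_def using I b by (intro continuous_map_sum) auto
  have nn: "b i y \<ge> 0" if "i \<in> I" for i y using b I that by auto
  have s0: "s y \<ge> 0" for y unfolding s_def using nn by (intro sum_nonneg)
  have s1: "s y \<ge> 1/2" if y: "y \<in> K" for y
  proof -
    obtain i where i: "i \<in> I" "b i y > 1/2" using I y by (auto simp: N_def)
    have "b i y \<le> s y" unfolding s_def using I i nn by (intro member_le_sum) auto
    then show ?thesis using i by linarith
  qed
  \<comment> \<open>The maximum keeps the denominator positive everywhere, yet equals
    \<open>s y\<close> on \<open>K\<close>, so the quotients sum to exactly 1 there and to at most 1
    elsewhere.\<close>
  define u where "u i y = b i y / max (s y) (1/2)" for i y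
  have sum: "(\<Sum>i\<in>I. u i y) = s y / max (s y) (1/2)" for y
    unfolding u_def s_def by (simp add: sum_divide_distrib)
  show thesis
  proof (rule that[of I u C])
    show "continuous_map X euclidean (u i)" if "i \<in> I" for i
      unfolding u_def using b I s that
      by (intro continuous_map_real_divide continuous_map_real_max) auto
    show "(\<Sum>i\<in>I. u i x) \<le> 1" for x
      unfolding sum using s0[of x] by (simp add: divide_le_eq_1 less_max_iff_disj)
    show "(\<Sum>i\<in>I. u i x) = 1" if "x \<in> K" for x
      unfolding sum using s1[OF that] by (simp add: max_def)
    show "x \<in> C i" if "i \<in> I" "x \<in> topspace X" "u i x \<noteq> 0" for i x
      using that b I by (auto simp: u_def)
    show "u i x \<ge> 0" if "i \<in> I" for i x
      using nn[OF that] by (simp add: u_def)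
    show "compactin X (C i)" "C i \<subseteq> U i" if "i \<in> I" for i
      using that b(4,5) I(2) by blast+
  qed (use I in auto)
qed

text \<open>The sum of a partition of unity for the trivial cover by the whole space is the required
  function; the compact sets \<open>C i\<close> bound its support.\<close>

lemma Urysohn_Cc:
  assumes X: "Hausdorff_space X" "locally_compact_space X" and K: "compactin X K"
  obtains u where "u \<in> Cc X" "\<And>x. x \<in> K \<Longrightarrow> u x = 1"
proof -
  obtain I and u :: "'a \<Rightarrow> 'a \<Rightarrow> real" and C where I: "finite I" "I \<subseteq> K"
    "\<And>i. i \<in> I \<Longrightarrow> continuous_map X euclidean (u i)"
    "\<And>i. i \<in> I \<Longrightarrow> compactin X (C i)"
    "\<And>i x. i \<in> I \<Longrightarrow> x \<in> topspace X \<Longrightarrow> u i x \<noteq> 0 \<Longrightarrow> x \<in> C i"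
    "\<And>x. x \<in> K \<Longrightarrow> (\<Sum>i\<in>I. u i x) = 1"
    using partition_of_unity[OF X K, of "\<lambda>_. topspace X"] compactin_subset_topspace[OF K]
    by (smt (verit) openin_topspace subsetD)
  have "(\<lambda>x. complex_of_real (u i x)) \<in> Cc X" if "i \<in> I" for i
    using I that by (intro CcI[OF X(1) _ I(4)[OF that]] continuous_map_of_real) auto
  then have "(\<lambda>x. \<Sum>i\<in>I. complex_of_real (u i x)) \<in> Cc X" by (rule Cc_sum[OF X(1)])
  moreover have "(\<Sum>i\<in>I. complex_of_real (u i x)) = 1" if "x \<in> K" for x
    using I(6)[OF that] by (metis of_real_1 of_real_sum)
  ultimately show thesis using that by blast
qed

section \<open>Fubini's theorem\<close>

text \<open>The open set where \<open>F\<close> differs from its slice at \<open>x0\<close> by less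
  than \<open>e\<close> contains \<open>{x0} \<times> L\<close>, hence a tube around it. Off
  \<open>L\<close> both slices vanish, so the estimate holds for all \<open>y\<close>.\<close>

lemma uniform_slices:
  fixes F :: "'a \<Rightarrow> 'b \<Rightarrow> complex"
  assumes F: "continuous_map (prod_topology X Y) euclidean (\<lambda>(x, y). F x y)"
    and L: "compactin Y L"
      "\<And>x y. x \<in> topspace X \<Longrightarrow> y \<in> topspace Y \<Longrightarrow> F x y \<noteq> 0 \<Longrightarrow> y \<in> L"
    and x0: "x0 \<in> topspace X" and e: "e > 0"
  obtains U where "openin X U" "x0 \<in> U"
    "\<And>x y. x \<in> U \<Longrightarrow> y \<in> topspace Y \<Longrightarrow> cmod (F x y - F x0 y) < e"
proof -
  define d where "d z = cmod ((\<lambda>(x, y). F x y) z - (\<lambda>(x, y). F x y) (x0, snd z))" for z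
  have "continuous_map (prod_topology X Y) euclidean d"
    unfolding d_def using x0
    by (intro continuous_map_norm continuous_map_diff F continuous_map_compose'[OF F]
        continuous_map_pairedI continuous_map_snd) auto
  then have "openin (prod_topology X Y) {z \<in> topspace (prod_topology X Y). d z \<in> {..<e}}"
    by (rule openin_continuous_map_preimage) auto
  moreover have "{x0} \<times> L \<subseteq> {z \<in> topspace (prod_topology X Y). d z \<in> {..<e}}"
    using x0 e compactin_subset_topspace[OF L(1)] by (auto simp: d_def)
  ultimately obtain U V where UV: "openin X U" "openin Y V" "x0 \<in> U" "L \<subseteq> V"
    "U \<times> V \<subseteq> {z \<in> topspace (prod_topology X Y). d z \<in> {..<e}}"
    using tube_lemma_right[OF _ L(1) x0] by meson
  show thesis
  proof (rule that[OF UV(1,3)])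
    fix x y assume xy: "x \<in> U" "y \<in> topspace Y"
    then have x: "x \<in> topspace X" using UV openin_subset by blast
    show "cmod (F x y - F x0 y) < e"
    proof (cases "y \<in> L")
      case True
      then have "(x, y) \<in> U \<times> V" using xy UV by auto
      then show ?thesis using UV(5) by (auto simp: d_def)
    next
      case False
      then have "F x y = 0" "F x0 y = 0" using L(2) x xy x0 by blast+
      then show ?thesis using e by simp
    qed
  qed
qed

lemma Cc_slice:
  fixes F :: "'a \<Rightarrow> 'b \<Rightarrow> complex"
  assumes Y: "Hausdorff_space Y"
    and F: "continuous_map (prod_topology X Y) euclidean (\<lambda>(x, y). F x y)"
    and L: "compactin Y L" "\<And>y. y \<in> topspace Y \<Longrightarrow> F x y \<noteq> 0 \<Longrightarrow> y \<in> L"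
    and x: "x \<in> topspace X"
  shows "F x \<in> Cc Y"
proof -
  have "continuous_map Y euclidean (\<lambda>y. (\<lambda>(x, y). F x y) (x, y))"
    using x by (intro continuous_map_compose'[OF F] continuous_map_pairedI) auto
  then show ?thesis by (intro CcI[OF Y _ L]) auto
qed

text \<open>Nearby slices are uniformly close and all supported in \<open>L\<close>, so a single
  continuity constant of \<nu> controls their integrals.\<close>

lemma Cc_integral:
  fixes F :: "'a \<Rightarrow> 'b \<Rightarrow> complex"
  assumes X: "Hausdorff_space X" and Y: "Hausdorff_space Y"
    and \<nu>: "radon_measure Y \<nu>"
    and F: "continuous_map (prod_topology X Y) euclidean (\<lambda>(x, y). F x y)"
    and K: "compactin X K" and L: "compactin Y L"
    and supp: "\<And>x y. x \<in> topspace X \<Longrightarrow> y \<in> topspace Y \<Longrightarrow> F x y \<noteq> 0 \<Longrightarrow> x \<in> K \<and> y \<in> L"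
  shows "(\<lambda>x. \<nu> (F x)) \<in> Cc X"
proof (rule CcI[OF X _ K])
  have slice: "F x \<in> Cc Y" if "x \<in> topspace X" for x
    using supp that by (intro Cc_slice[OF Y F L _ that]) auto
  show "x \<in> K" if "x \<in> topspace X" "\<nu> (F x) \<noteq> 0" for x
  proof (rule ccontr)
    assume "x \<notin> K"
    then have "F x y = 0" if "y \<in> topspace Y" for y
      using supp \<open>x \<in> topspace X\<close> that by blast
    then have "\<nu> (F x) = \<nu> (\<lambda>y. 0)"
      by (intro radon_cong[OF Y \<nu> slice[OF that(1)]])
    then show False using that radon_zero[OF Y \<nu>] by simp
  qed
  obtain C where C: "C \<ge> 0" "\<And>f e. \<lbrakk>f \<in> Cc Y; e \<ge> 0; \<And>x. x \<in> topspace Y \<Longrightarrow> f x \<noteq> 0 \<Longrightarrow> x \<in> L;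
       \<And>x. x \<in> topspace Y \<Longrightarrow> cmod (f x) \<le> e\<rbrakk> \<Longrightarrow> cmod (\<nu> f) \<le> C * e"
    using radon_bound[OF Y \<nu> L] by metis
  have "\<exists>U. openin X U \<and> x \<in> U \<and> (\<forall>y\<in>U. \<nu> (F y) \<in> ball (\<nu> (F x)) \<epsilon>)"
    if x: "x \<in> topspace X" and e: "\<epsilon> > 0" for x \<epsilon>
  proof -
    \<comment> \<open>The summand 1 covers \<open>C = 0\<close> and makes
      \<open>C * e < \<epsilon>\<close> strict.\<close>
    define e where "e = \<epsilon> / (C + 1)"
    have e0: "e > 0" "C * e < \<epsilon>" using e C(1) by (auto simp: e_def field_simps)
    obtain U where U: "openin X U" "x \<in> U"
      "\<And>x' y. x' \<in> U \<Longrightarrow> y \<in> topspace Y \<Longrightarrow> cmod (F x' y - F x y) < e"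
      using uniform_slices[OF F L _ x e0(1)] supp by metis
    have "dist (\<nu> (F x)) (\<nu> (F x')) < \<epsilon>" if x': "x' \<in> U" for x'
    proof -
      have t: "x' \<in> topspace X" using U x' openin_subset by blast
      have "cmod (\<nu> (\<lambda>y. F x' y - F x y)) \<le> C * e"
      proof (rule C(2))
        show "y \<in> L" if "y \<in> topspace Y" "F x' y - F x y \<noteq> 0" for y
          using supp[OF t that(1)] supp[OF x that(1)] that(2) by (cases "F x y = 0") auto
      qed (use slice t x Y U x' e0 in \<open>auto intro!: Cc_diff less_imp_le\<close>)
      then show ?thesis using e0 radon_diff[OF Y \<nu> slice[OF t] slice[OF x]]
        by (simp add: dist_norm norm_minus_commute)
    qed
    then show ?thesis using U by auto
  qed
  then show "continuous_map X euclidean (\<lambda>x. \<nu> (F x))"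
    using Met_TC.continuous_map_to_metric[of X "\<lambda>x. \<nu> (F x)"] by auto
qed

text \<open>A partition of unity approximates \<open>F x y\<close> uniformly by finite sums \<open>\<Sum>i. u i x * F i y\<close>
  with supports in a fixed compact set; for these the two iterated integrals agree.\<close>

lemma radon_Fubini:
  fixes F :: "'a \<Rightarrow> 'b \<Rightarrow> complex"
  assumes X: "Hausdorff_space X" "locally_compact_space X" and Y: "Hausdorff_space Y"
    and \<mu>: "radon_measure X \<mu>" and \<nu>: "radon_measure Y \<nu>"
    and F: "continuous_map (prod_topology X Y) euclidean (\<lambda>(x, y). F x y)"
    and K: "compactin X K" and L: "compactin Y L"
    and supp: "\<And>x y. x \<in> topspace X \<Longrightarrow> y \<in> topspace Y \<Longrightarrow> F x y \<noteq> 0 \<Longrightarrow> x \<in> K \<and> y \<in> L"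
  shows "\<mu> (\<lambda>x. \<nu> (\<lambda>y. F x y)) = \<nu> (\<lambda>y. \<mu> (\<lambda>x. F x y))"
proof -
  obtain u0 where u0: "u0 \<in> Cc X" "\<And>x. x \<in> K \<Longrightarrow> u0 x = 1"
    using Urysohn_Cc[OF X K] by blast
  \<comment> \<open>The partition functions spill over \<open>K\<close>. Confining them to the open
    set \<open>V\<close> keeps them in \<open>K'\<close>, which is fixed before \<open>e\<close>, so
    that the constant \<open>A\<close> does not depend on \<open>e\<close>.\<close>
  define K' where "K' = fun_supp X u0"
  have K': "compactin X K'" using CcD u0 by (auto simp: K'_def)
  define V where "V = {x \<in> topspace X. u0 x \<in> - {0}}"
  have V: "openin X V"
    unfolding V_def using CcD(1)[OF u0(1)] by (rule openin_continuous_map_preimage) auto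
  have KV: "K \<subseteq> V" "V \<subseteq> K'"
    using compactin_subset_topspace[OF K] u0 in_fun_supp by (force simp: V_def K'_def)+
  obtain A where A: "A \<ge> 0" "\<And>f e. \<lbrakk>f \<in> Cc X; e \<ge> 0; \<And>x. x \<in> topspace X \<Longrightarrow> f x \<noteq> 0 \<Longrightarrow> x \<in> K';
       \<And>x. x \<in> topspace X \<Longrightarrow> cmod (f x) \<le> e\<rbrakk> \<Longrightarrow> cmod (\<mu> f) \<le> A * e"
    using radon_bound[OF X(1) \<mu> K'] by metis
  obtain B where B: "B \<ge> 0" "\<And>f e. \<lbrakk>f \<in> Cc Y; e \<ge> 0; \<And>x. x \<in> topspace Y \<Longrightarrow> f x \<noteq> 0 \<Longrightarrow> x \<in> L;
       \<And>x. x \<in> topspace Y \<Longrightarrow> cmod (f x) \<le> e\<rbrakk> \<Longrightarrow> cmod (\<nu> f) \<le> B * e"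
    using radon_bound[OF Y \<nu> L] by metis
  have F': "continuous_map (prod_topology Y X) euclidean (\<lambda>(y, x). F x y)"
    using continuous_map_compose'[OF F continuous_map_pairedI[OF continuous_map_snd continuous_map_fst]]
    by (simp add: case_prod_unfold)
  have small: "cmod (\<mu> (\<lambda>x. \<nu> (\<lambda>y. F x y)) - \<nu> (\<lambda>y. \<mu> (\<lambda>x. F x y))) \<le> 2 * (A * (B * e))"
    if e: "e > 0" for e
  proof -
    have "\<forall>x\<in>K. \<exists>U. openin X U \<and> x \<in> U \<and> (\<forall>x'\<in>U. \<forall>y\<in>topspace Y. cmod (F x' y - F x y) < e)"
      using uniform_slices[OF F L _ _ e] supp compactin_subset_topspace[OF K] by (metis subsetD)
    then obtain U where U: "\<And>x. x \<in> K \<Longrightarrow> openin X (U x)" "\<And>x. x \<in> K \<Longrightarrow> x \<in> U x"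
      "\<And>x x' y. x \<in> K \<Longrightarrow> x' \<in> U x \<Longrightarrow> y \<in> topspace Y \<Longrightarrow> cmod (F x' y - F x y) < e"
      by metis
    obtain I and u :: "'a \<Rightarrow> 'a \<Rightarrow> real" and C where I: "finite I" "I \<subseteq> K"
      "\<And>i. i \<in> I \<Longrightarrow> continuous_map X euclidean (u i)"
      "\<And>i. i \<in> I \<Longrightarrow> compactin X (C i)" "\<And>i. i \<in> I \<Longrightarrow> C i \<subseteq> U i \<inter> V"
      "\<And>i x. i \<in> I \<Longrightarrow> x \<in> topspace X \<Longrightarrow> u i x \<noteq> 0 \<Longrightarrow> x \<in> C i"
      "\<And>i x. i \<in> I \<Longrightarrow> u i x \<ge> 0"
      "\<And>x. (\<Sum>i\<in>I. u i x) \<le> 1"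
      "\<And>x. x \<in> K \<Longrightarrow> (\<Sum>i\<in>I. u i x) = 1"
      by (rule partition_of_unity[OF X K, of "\<lambda>x. U x \<inter> V"]) (use U V KV in \<open>auto\<close>)
    have IX: "i \<in> topspace X" if "i \<in> I" for i
      using that I(2) compactin_subset_topspace[OF K] by auto
    define c where "c i x = complex_of_real (u i x)" for i x
    have c: "c i \<in> Cc X" if "i \<in> I" for i
      unfolding c_def using I that by (intro CcI[OF X(1) _ I(4)[OF that]] continuous_map_of_real) auto
    have sl: "F i \<in> Cc Y" if "i \<in> I" for i
      using supp IX that by (intro Cc_slice[OF Y F L]) auto
    define S where "S x y = (\<Sum>i\<in>I. c i x * F i y)" for x y
    define D where "D x y = F x y - S x y" for x y
    have D_le: "cmod (D x y) \<le> e" if x: "x \<in> topspace X" and y: "y \<in> topspace Y" for x y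
    proof -
      \<comment> \<open>The partition functions sum to 1 only on \<open>K\<close>; elsewhere
        \<open>F x y = 0\<close>.\<close>
      have "F x y = (\<Sum>i\<in>I. c i x) * F x y"
      proof (cases "x \<in> K")
        case True
        then have "(\<Sum>i\<in>I. c i x) = 1"
          unfolding c_def using I(9) by (metis of_real_1 of_real_sum)
        then show ?thesis by simp
      next
        case False
        then have "F x y = 0" using supp x y by blast
        then show ?thesis by simp
      qed
      then have "D x y = (\<Sum>i\<in>I. c i x * (F x y - F i y))"
        by (simp add: D_def S_def sum_distrib_right right_diff_distrib sum_subtractf)
      also have "cmod \<dots> \<le> (\<Sum>i\<in>I. u i x * e)"
      proof (rule sum_norm_le)
        fix i assume i: "i \<in> I"
        show "cmod (c i x * (F x y - F i y)) \<le> u i x * e"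
        proof (cases "u i x = 0")
          case False
          then have "x \<in> U i" using I(5,6) i x by blast
          then have "cmod (F x y - F i y) \<le> e" using U(3)[of i x y] I(2) i y by auto
          then show ?thesis using I(7)[OF i] by (simp add: c_def norm_mult mult_left_mono)
        qed (simp add: c_def)
      qed
      also have "\<dots> = (\<Sum>i\<in>I. u i x) * e" by (simp add: sum_distrib_right)
      also have "\<dots> \<le> e" using I(8)[of x] e by (simp add: mult_left_le_one_le I(7) sum_nonneg)
      finally show ?thesis .
    qed
    have S_cont: "continuous_map (prod_topology X Y) euclidean (\<lambda>(x, y). S x y)"
      unfolding S_def case_prod_unfold
    proof (intro continuous_map_sum[OF I(1)] continuous_map_mult)
      show "continuous_map (prod_topology X Y) euclidean (\<lambda>z. c i (fst z))" if "i \<in> I" for i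
        by (rule continuous_map_compose'[OF CcD(1)[OF c[OF that]] continuous_map_fst])
      show "continuous_map (prod_topology X Y) euclidean (\<lambda>z. F i (snd z))" if "i \<in> I" for i
        by (rule continuous_map_compose'[OF CcD(1)[OF sl[OF that]] continuous_map_snd])
    qed
    have D_cont: "continuous_map (prod_topology X Y) euclidean (\<lambda>(x, y). D x y)"
      using continuous_map_diff[OF F S_cont] by (simp add: D_def case_prod_unfold)
    have D_cont': "continuous_map (prod_topology Y X) euclidean (\<lambda>(y, x). D x y)"
      using continuous_map_compose'[OF D_cont continuous_map_pairedI[OF continuous_map_snd continuous_map_fst]]
      by (simp add: case_prod_unfold)
    have S_supp: "x \<in> K' \<and> y \<in> L" if "x \<in> topspace X" "y \<in> topspace Y" "S x y \<noteq> 0" for x y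
    proof -
      obtain i where i: "i \<in> I" "c i x * F i y \<noteq> 0"
        using \<open>S x y \<noteq> 0\<close> unfolding S_def by (meson sum.not_neutral_contains_not_neutral)
      then have "x \<in> C i" using I(6) that by (auto simp: c_def)
      then have "x \<in> K'" using I(5) KV i by blast
      moreover have "y \<in> L" using i supp[OF IX] that by auto
      ultimately show ?thesis ..
    qed
    have D_supp: "x \<in> K' \<and> y \<in> L" if "x \<in> topspace X" "y \<in> topspace Y" "D x y \<noteq> 0" for x y
      using supp[OF that(1,2)] S_supp[OF that(1,2)] that(3) KV
      by (cases "F x y = 0"; cases "S x y = 0") (auto simp: D_def)
    \<comment> \<open>The continuity bounds are nested: the inner integral is at most
      \<open>B * e\<close> in modulus and, as a function of \<open>x\<close>, vanishes off
      \<open>K'\<close>.\<close>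
    have D1: "cmod (\<mu> (\<lambda>x. \<nu> (\<lambda>y. D x y))) \<le> A * (B * e)"
    proof (rule A(2))
      show "(\<lambda>x. \<nu> (D x)) \<in> Cc X"
        using Cc_integral[OF X(1) Y \<nu> D_cont K' L D_supp] .
      then show "x \<in> K'" if "x \<in> topspace X" "\<nu> (D x) \<noteq> 0" for x
        using radon_cong[OF Y \<nu> Cc_zero[OF Y], of "D x"] radon_zero[OF Y \<nu>] D_supp that by metis
      show "cmod (\<nu> (D x)) \<le> B * e" if "x \<in> topspace X" for x
        using D_supp that e D_le by (intro B(2) Cc_slice[OF Y D_cont L]) auto
    qed (use B e in auto)
    have D2: "cmod (\<nu> (\<lambda>y. \<mu> (\<lambda>x. D x y))) \<le> B * (A * e)"
    proof (rule B(2))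
      show "(\<lambda>y. \<mu> (\<lambda>x. D x y)) \<in> Cc Y"
        using D_supp by (intro Cc_integral[OF Y X(1) \<mu> D_cont' L K']) auto
      then show "y \<in> L" if "y \<in> topspace Y" "\<mu> (\<lambda>x. D x y) \<noteq> 0" for y
        using radon_cong[OF X(1) \<mu> Cc_zero[OF X(1)], of "\<lambda>x. D x y"] radon_zero[OF X(1) \<mu>] D_supp that
        by metis
      show "cmod (\<mu> (\<lambda>x. D x y)) \<le> A * e" if "y \<in> topspace Y" for y
        using D_supp that e D_le by (intro A(2) Cc_slice[OF X(1) D_cont' K']) auto
    qed (use A e in auto)
    have S1: "\<nu> (\<lambda>y. S x y) = (\<Sum>i\<in>I. c i x * \<nu> (F i))" for x
      unfolding S_def by (subst radon_sum[OF Y \<nu>]) (simp_all add: radon_cmult[OF \<nu>] Cc_cmult[OF Y] sl)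
    have S2: "\<mu> (\<lambda>x. S x y) = (\<Sum>i\<in>I. \<mu> (c i) * F i y)" for y
      unfolding S_def by (subst radon_sum[OF X(1) \<mu>]) (simp_all add: radon_multc[OF \<mu>] Cc_multc[OF X(1)] c)
    \<comment> \<open>Both sides reduce to the sum of the products
      \<open>\<mu> (c i) * \<nu> (F i)\<close>.\<close>
    have S12: "\<mu> (\<lambda>x. \<nu> (\<lambda>y. S x y)) = \<nu> (\<lambda>y. \<mu> (\<lambda>x. S x y))"
      unfolding S1 S2 using c sl
      by (simp add: radon_sum[OF X(1) \<mu>] radon_sum[OF Y \<nu>] Cc_cmult[OF Y] Cc_multc[OF X(1)]
          radon_multc[OF \<mu>] radon_cmult[OF \<nu>])
    have "\<mu> (\<lambda>x. \<nu> (\<lambda>y. D x y)) = \<mu> (\<lambda>x. \<nu> (\<lambda>y. F x y) - \<nu> (\<lambda>y. S x y))"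
    proof (rule radon_cong[OF X(1) \<mu>])
      show "(\<lambda>x. \<nu> (D x)) \<in> Cc X"
        using Cc_integral[OF X(1) Y \<nu> D_cont K' L D_supp] .
      show "\<nu> (D x) = \<nu> (F x) - \<nu> (S x)" if "x \<in> topspace X" for x
        unfolding D_def using supp S_supp that
        by (intro radon_diff[OF Y \<nu>] Cc_slice[OF Y F L] Cc_slice[OF Y S_cont L]) auto
    qed
    also have "\<dots> = \<mu> (\<lambda>x. \<nu> (\<lambda>y. F x y)) - \<mu> (\<lambda>x. \<nu> (\<lambda>y. S x y))"
      by (rule radon_diff[OF X(1) \<mu> Cc_integral[OF X(1) Y \<nu> F K L supp]
            Cc_integral[OF X(1) Y \<nu> S_cont K' L S_supp]])
    finally have E1: "\<mu> (\<lambda>x. \<nu> (\<lambda>y. D x y)) = \<mu> (\<lambda>x. \<nu> (\<lambda>y. F x y)) - \<mu> (\<lambda>x. \<nu> (\<lambda>y. S x y))" .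
    have S_cont': "continuous_map (prod_topology Y X) euclidean (\<lambda>(y, x). S x y)"
      using continuous_map_compose'[OF S_cont continuous_map_pairedI[OF continuous_map_snd continuous_map_fst]]
      by (simp add: case_prod_unfold)
    have "\<nu> (\<lambda>y. \<mu> (\<lambda>x. D x y)) = \<nu> (\<lambda>y. \<mu> (\<lambda>x. F x y) - \<mu> (\<lambda>x. S x y))"
    proof (rule radon_cong[OF Y \<nu>])
      show "(\<lambda>y. \<mu> (\<lambda>x. D x y)) \<in> Cc Y"
        using D_supp by (intro Cc_integral[OF Y X(1) \<mu> D_cont' L K']) auto
      show "\<mu> (\<lambda>x. D x y) = \<mu> (\<lambda>x. F x y) - \<mu> (\<lambda>x. S x y)" if "y \<in> topspace Y" for y
        unfolding D_def using supp S_supp that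
        by (intro radon_diff[OF X(1) \<mu>] Cc_slice[OF X(1) F' K] Cc_slice[OF X(1) S_cont' K']) auto
    qed
    also have "\<dots> = \<nu> (\<lambda>y. \<mu> (\<lambda>x. F x y)) - \<nu> (\<lambda>y. \<mu> (\<lambda>x. S x y))"
      using supp S_supp
      by (intro radon_diff[OF Y \<nu>] Cc_integral[OF Y X(1) \<mu> F' L K]
            Cc_integral[OF Y X(1) \<mu> S_cont' L K']) auto
    finally have E2: "\<nu> (\<lambda>y. \<mu> (\<lambda>x. D x y)) = \<nu> (\<lambda>y. \<mu> (\<lambda>x. F x y)) - \<nu> (\<lambda>y. \<mu> (\<lambda>x. S x y))" .
    have "\<mu> (\<lambda>x. \<nu> (\<lambda>y. F x y)) - \<nu> (\<lambda>y. \<mu> (\<lambda>x. F x y))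
      = \<mu> (\<lambda>x. \<nu> (\<lambda>y. D x y)) - \<nu> (\<lambda>y. \<mu> (\<lambda>x. D x y))"
      unfolding E1 E2 S12 by simp
    also have "cmod \<dots> \<le> A * (B * e) + B * (A * e)"
      using D1 D2 by (meson add_mono norm_triangle_ineq4 order_trans)
    finally show ?thesis by (simp add: algebra_simps)
  qed
  have "cmod (\<mu> (\<lambda>x. \<nu> (\<lambda>y. F x y)) - \<nu> (\<lambda>y. \<mu> (\<lambda>x. F x y))) \<le> 0 + e" if e: "e > 0" for e
  proof -
    \<comment> \<open>The estimate \<open>small\<close> is applied with this rescaled
      \<open>e\<close>; adding 1 avoids division by zero when \<open>A * B = 0\<close>.\<close>
    have "2 * (A * (B * (e / (2 * (A * B + 1))))) \<le> e"
      using A B e by (simp add: field_simps add_pos_nonneg)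
    moreover have "e / (2 * (A * B + 1)) > 0"
      using A B e by (simp add: add_nonneg_pos)
    ultimately show ?thesis using small by (smt (verit))
  qed
  then have "cmod (\<mu> (\<lambda>x. \<nu> (\<lambda>y. F x y)) - \<nu> (\<lambda>y. \<mu> (\<lambda>x. F x y))) \<le> 0"
    by (rule field_le_epsilon)
  then show ?thesis by simp
qed

section \<open>Haar measures\<close>

text \<open>The nonzero set of the composite lies in the image of the support of \<open>f\<close>
  under the continuous left inverse \<open>t'\<close>, which is compact. It serves for translations
  and inversion.\<close>

lemma Cc_compose:
  assumes X: "Hausdorff_space X" and f: "f \<in> Cc Y"
    and t: "continuous_map X Y t" and t': "continuous_map Y X t'"
    and inv: "\<And>x. x \<in> topspace X \<Longrightarrow> t' (t x) = x"
  shows "(\<lambda>x. f (t x)) \<in> Cc X"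
proof (rule CcI[OF X])
  show "continuous_map X euclidean (\<lambda>x. f (t x))"
    by (rule continuous_map_compose'[OF CcD(1)[OF f] t])
  show "compactin X (t' ` fun_supp Y f)"
    by (rule image_compactin[OF CcD(2)[OF f] t'])
  show "x \<in> t' ` fun_supp Y f" if "x \<in> topspace X" "f (t x) \<noteq> 0" for x
  proof -
    have "t x \<in> fun_supp Y f"
      using t that by (intro in_fun_supp) (auto simp: continuous_map_def)
    then show ?thesis using inv[OF that(1)] by (metis imageI)
  qed
qed

context locally_compact_group
begin

section \<open>Translations, inversion and Haar integrals on a locally compact group\<close>

lemma continuous_map_group_mult:
  assumes "continuous_map X T f" "continuous_map X T g"
  shows "continuous_map X T (\<lambda>x. f x \<otimes> g x)"
  using continuous_map_compose'[OF continuous_mult continuous_map_pairedI[OF assms]] by simp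

lemma continuous_map_group_inv:
  assumes "continuous_map X T f"
  shows "continuous_map X T (\<lambda>x. inv (f x))"
  using continuous_map_compose'[OF continuous_inv assms] by simp

lemma continuous_map_lmult: "x \<in> carrier G \<Longrightarrow> continuous_map T T (\<lambda>g. x \<otimes> g)"
  by (intro continuous_map_group_mult) (auto simp: topspace_eq_carrier)

lemma continuous_map_rmult: "x \<in> carrier G \<Longrightarrow> continuous_map T T (\<lambda>g. g \<otimes> x)"
  by (intro continuous_map_group_mult) (auto simp: topspace_eq_carrier)

lemma compactin_set_mult:
  assumes "compactin T A" "compactin T B"
  shows "compactin T (A <#> B)"
proof -
  have "A <#> B = (\<lambda>(x, y). x \<otimes> y) ` (A \<times> B)"
    by (auto simp: set_mult_def)
  moreover have "compactin (prod_topology T T) (A \<times> B)"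
    using assms by (simp add: compactin_Times)
  ultimately show ?thesis
    using image_compactin[OF _ continuous_mult] by simp
qed

lemma compactin_inv_image:
  assumes "compactin T A"
  shows "compactin T (m_inv G ` A)"
  by (rule image_compactin[OF assms continuous_inv])

lemma Cc_lmult:
  assumes "f \<in> Cc T" "x \<in> carrier G"
  shows "(\<lambda>g. f (x \<otimes> g)) \<in> Cc T"
  by (rule Cc_compose[OF Hausdorff assms(1) continuous_map_lmult continuous_map_lmult[of "inv x"]])
     (simp_all add: topspace_eq_carrier assms(2) flip: m_assoc)

lemma Cc_rmult:
  assumes "f \<in> Cc T" "x \<in> carrier G"
  shows "(\<lambda>g. f (g \<otimes> x)) \<in> Cc T"
  by (rule Cc_compose[OF Hausdorff assms(1) continuous_map_rmult continuous_map_rmult[of "inv x"]])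
     (simp_all add: topspace_eq_carrier assms(2) m_assoc)

lemma Cc_inv:
  assumes "f \<in> Cc T"
  shows "(\<lambda>g. f (inv g)) \<in> Cc T"
  by (rule Cc_compose[OF Hausdorff assms continuous_inv continuous_inv])
     (simp add: topspace_eq_carrier)

lemma set_mult_inv_imageI:
  assumes "g \<in> carrier G" "h \<in> carrier G" "g \<in> A" "g \<otimes> h \<in> B"
  shows "h \<in> m_inv G ` A <#> B"
proof -
  have "h = inv g \<otimes> (g \<otimes> h)" using assms by (simp flip: m_assoc)
  then show ?thesis using assms unfolding set_mult_def by blast
qed

text \<open>If \<open>\<mu> f = 0\<close>, then \<open>\<mu>\<close> vanishes on every \<open>h \<ge> 0\<close>: a partition of unity splits \<open>h\<close> into pieces
  that are dominated by multiples of left translates of \<open>f\<close>.\<close>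

lemma haar_faithful:
  assumes haar: "left_haar_measure G T \<mu>" and f: "f \<in> Cc T"
    and nonneg: "\<And>x. x \<in> carrier G \<Longrightarrow> f x \<in> \<real>\<^sub>\<ge>\<^sub>0" and x: "x \<in> carrier G" "f x \<noteq> 0"
  shows "\<mu> f \<noteq> 0"
proof
  assume zero: "\<mu> f = 0"
  have \<mu>: "radon_measure T \<mu>"
    and pos: "\<And>f. f \<in> Cc T \<Longrightarrow> (\<And>x. x \<in> carrier G \<Longrightarrow> f x \<in> \<real>\<^sub>\<ge>\<^sub>0) \<Longrightarrow> \<mu> f \<in> \<real>\<^sub>\<ge>\<^sub>0"
    and li: "\<And>f x. f \<in> Cc T \<Longrightarrow> x \<in> carrier G \<Longrightarrow> \<mu> (\<lambda>g. f (x \<otimes> g)) = \<mu> f"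
    using haar by (auto simp: left_haar_measure_def topspace_eq_carrier)
  \<comment> \<open>With value 2a at the point, the strict condition that the real part exceeds
    \<open>a\<close> holds on an open neighbourhood.\<close>
  obtain a where a: "a > 0" "f x = complex_of_real (2 * a)"
  proof -
    obtain r where r: "f x = complex_of_real r" "r \<ge> 0"
      using nonneg[OF x(1)] nonneg_Reals_cases by blast
    have "r > 0" using r x by auto
    then show thesis using r by (intro that[of "r / 2"]) auto
  qed
  \<comment> \<open>The left translate of \<open>f\<close> that takes its value \<open>f x\<close>
    at \<open>k\<close>; by invariance its integral is still 0.\<close>
  define tr where "tr k y = f (x \<otimes> (inv k \<otimes> y))" for k y
  have tr: "tr k \<in> Cc T" "\<mu> (tr k) = 0" if k: "k \<in> carrier G" for k
  proof -
    have 1: "(\<lambda>g. f (x \<otimes> g)) \<in> Cc T" by (rule Cc_lmult[OF f x(1)])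
    show "tr k \<in> Cc T"
      unfolding tr_def using Cc_lmult[OF 1, of "inv k"] k by simp
    show "\<mu> (tr k) = 0"
      unfolding tr_def using li[OF 1, of "inv k"] li[OF f x(1)] k zero by simp
  qed
  have nonneg_zero: "\<mu> h = 0" if h: "h \<in> Cc T" "\<And>y. y \<in> carrier G \<Longrightarrow> h y \<in> \<real>\<^sub>\<ge>\<^sub>0" for h
  proof -
    define K where "K = fun_supp T h"
    have K: "compactin T K" "K \<subseteq> carrier G"
      using CcD(2)[OF h(1)] compactin_subset_topspace[of T K]
      by (auto simp: K_def topspace_eq_carrier)
    define U where "U k = {y \<in> topspace T. Re (tr k y) \<in> {a<..}}" for k
    have U: "openin T (U k)" "k \<in> U k" if k: "k \<in> K" for k
    proof -
      have kc: "k \<in> carrier G" using K k by blast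
      have "continuous_map T euclidean (\<lambda>y. Re (tr k y))"
        using CcD(1)[OF tr(1)[OF kc]] by (simp add: continuous_map_atin tendsto_Re)
      then show "openin T (U k)"
        unfolding U_def by (rule openin_continuous_map_preimage) auto
      show "k \<in> U k"
        using kc a x by (simp add: U_def tr_def topspace_eq_carrier)
    qed
    obtain I and u :: "'a \<Rightarrow> 'a \<Rightarrow> real" and C where I: "finite I" "I \<subseteq> K"
      "\<And>i. i \<in> I \<Longrightarrow> continuous_map T euclidean (u i)"
      "\<And>i. i \<in> I \<Longrightarrow> compactin T (C i)" "\<And>i. i \<in> I \<Longrightarrow> C i \<subseteq> U i"
      "\<And>i x. i \<in> I \<Longrightarrow> x \<in> topspace T \<Longrightarrow> u i x \<noteq> 0 \<Longrightarrow> x \<in> C i"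
      "\<And>i x. i \<in> I \<Longrightarrow> u i x \<ge> 0"
      "\<And>x. (\<Sum>i\<in>I. u i x) \<le> 1"
      "\<And>x. x \<in> K \<Longrightarrow> (\<Sum>i\<in>I. u i x) = 1"
      by (rule partition_of_unity[OF Hausdorff locally_compact K(1), of U]) (use U in auto)
    have "compactin euclidean (h ` K)"
      by (rule image_compactin[OF K(1) CcD(1)[OF h(1)]])
    then obtain M where M: "M > 0" "\<And>y. y \<in> K \<Longrightarrow> cmod (h y) \<le> M"
      using compact_imp_bounded bounded_pos by (metis compactin_euclidean_iff imageI)
    define p where "p i y = complex_of_real (u i y) * h y" for i y
    have p: "p i \<in> Cc T" if "i \<in> I" for i
      unfolding p_def using I(3)[OF that] by (intro Cc_mult_left[OF Hausdorff _ h(1)] continuous_map_of_real)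
    have p_zero: "\<mu> (p i) = 0" if i: "i \<in> I" for i
    proof -
      have ic: "i \<in> carrier G" using i I K by blast
      \<comment> \<open>Where \<open>p i\<close> is nonzero, \<open>tr i\<close> exceeds
        \<open>a\<close> while \<open>p i\<close> is at most \<open>M\<close>, so
        \<open>c * tr i\<close> dominates \<open>p i\<close>.\<close>
      define c where "c = complex_of_real (M / a)"
      have "\<mu> (\<lambda>y. c * tr i y - p i y) \<in> \<real>\<^sub>\<ge>\<^sub>0"
      proof (rule pos)
        show "(\<lambda>y. c * tr i y - p i y) \<in> Cc T"
          by (intro Cc_diff[OF Hausdorff] Cc_cmult[OF Hausdorff] tr(1)[OF ic] p i)
        fix y assume y: "y \<in> carrier G"
        obtain r where r: "h y = complex_of_real r" "r \<ge> 0"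
          using h(2)[OF y] nonneg_Reals_cases by blast
        obtain s where s: "tr i y = complex_of_real s" "s \<ge> 0"
          unfolding tr_def using nonneg[of "x \<otimes> (inv i \<otimes> y)"] x y ic nonneg_Reals_cases by blast
        have "u i y * r \<le> M / a * s"
        proof (cases "u i y = 0 \<or> r = 0")
          case True
          then show ?thesis using M a s by auto
        next
          case False
          then have "y \<in> U i" using I(5,6)[OF i] y by (auto simp: topspace_eq_carrier)
          then have "s > a" using s by (simp add: U_def)
          have "y \<in> K" unfolding K_def using False r y by (intro in_fun_supp) (auto simp: topspace_eq_carrier)
          then have "r \<le> M" using M(2)[of y] r by simp
          have "u i y \<le> (\<Sum>i\<in>I. u i y)" using I(1,7) i by (intro member_le_sum) auto
          then have "u i y \<le> 1" using I(8)[of y] by linarith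
          then have "u i y * r \<le> 1 * M" using \<open>r \<le> M\<close> r by (intro mult_mono) auto
          also have "M \<le> M / a * s" using \<open>s > a\<close> a M by (simp add: field_simps)
          finally show ?thesis by simp
        qed
        then have "c * tr i y - p i y = complex_of_real (M / a * s - u i y * r)" "M / a * s - u i y * r \<ge> 0"
          by (simp_all add: c_def p_def r s)
        then show "c * tr i y - p i y \<in> \<real>\<^sub>\<ge>\<^sub>0"
          by (simp only: nonneg_Reals_of_real_iff)
      qed
      moreover have "\<mu> (\<lambda>y. c * tr i y - p i y) = - \<mu> (p i)"
        using radon_diff[OF Hausdorff \<mu> Cc_cmult[OF Hausdorff tr(1)[OF ic]] p[OF i]]
          radon_cmult[OF \<mu> tr(1)[OF ic]] tr(2)[OF ic] by simp
      moreover have "\<mu> (p i) \<in> \<real>\<^sub>\<ge>\<^sub>0"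
      proof (rule pos[OF p[OF i]])
        show "p i y \<in> \<real>\<^sub>\<ge>\<^sub>0" if "y \<in> carrier G" for y
          unfolding p_def using h(2)[OF that] I(7)[OF i] by (intro nonneg_Reals_mult_I) auto
      qed
      ultimately show ?thesis
        \<comment> \<open>Both \<open>\<mu> (p i)\<close> and its negative are nonnegative
          reals.\<close>
        by (auto simp: complex_nonneg_Reals_iff complex_eq_iff)
    qed
    have "\<mu> h = \<mu> (\<lambda>y. \<Sum>i\<in>I. p i y)"
    proof (rule radon_cong[OF Hausdorff \<mu> h(1)])
      fix y assume y: "y \<in> topspace T"
      have "(\<Sum>i\<in>I. p i y) = (\<Sum>i\<in>I. complex_of_real (u i y)) * h y"
        by (simp add: p_def sum_distrib_right)
      also have "\<dots> = h y"
      proof (cases "y \<in> K")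
        case True
        then show ?thesis using I(9) by (metis mult_1 of_real_1 of_real_sum)
      next
        case False
        then show ?thesis using in_fun_supp[OF y] by (auto simp: K_def)
      qed
      finally show "h y = (\<Sum>i\<in>I. p i y)" ..
    qed
    also have "\<dots> = 0"
      using p p_zero by (simp add: radon_sum[OF Hausdorff \<mu>])
    finally show ?thesis .
  qed
  \<comment> \<open>For \<open>L\<close> equal to plus or minus the real or imaginary part these are
    the four nonnegative parts of \<open>h\<close>; \<open>L 0 = 0\<close> preserves compact
    support.\<close>
  have part_zero: "(\<lambda>y. complex_of_real (max (L (h y)) 0)) \<in> Cc T"
      "\<mu> (\<lambda>y. complex_of_real (max (L (h y)) 0)) = 0"
    if h: "h \<in> Cc T" and L: "continuous_on UNIV L" "L 0 = 0" for h and L :: "complex \<Rightarrow> real"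
  proof -
    show *: "(\<lambda>y. complex_of_real (max (L (h y)) 0)) \<in> Cc T"
    proof (rule CcI[OF Hausdorff _ CcD(2)[OF h]])
      have "continuous_map T euclidean (\<lambda>y. L (h y))"
        by (rule continuous_map_compose'[OF _ CcD(1)[OF h]]) (use L in simp)
      then show "continuous_map T euclidean (\<lambda>y. complex_of_real (max (L (h y)) 0))"
        by (intro continuous_map_of_real continuous_map_real_max) auto
    qed (use L in \<open>auto intro!: in_fun_supp\<close>)
    show "\<mu> (\<lambda>y. complex_of_real (max (L (h y)) 0)) = 0"
      by (rule nonneg_zero[OF *]) simp
  qed
  have "\<mu> h = 0" if h: "h \<in> Cc T" for h
  proof -
    define P where "P L y = complex_of_real (max (L (h y)) 0)" for L :: "complex \<Rightarrow> real" and y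
    have P: "P L \<in> Cc T" "\<mu> (P L) = 0" if "continuous_on UNIV L" "L 0 = 0" for L
      using part_zero[OF h that] unfolding P_def by auto
    note Ps = P[of Re] P[of "\<lambda>z. - Re z"] P[of Im] P[of "\<lambda>z. - Im z"]
    have cs: "continuous_on UNIV Re" "continuous_on UNIV (\<lambda>z. - Re z)"
      "continuous_on UNIV Im" "continuous_on UNIV (\<lambda>z. - Im z)"
      by (auto intro!: continuous_intros)
    have D: "(\<lambda>y. P Re y - P (\<lambda>z. - Re z) y) \<in> Cc T" "(\<lambda>y. P Im y - P (\<lambda>z. - Im z) y) \<in> Cc T"
      using Ps cs by (auto intro!: Cc_diff Hausdorff)
    have "h = (\<lambda>y. (P Re y - P (\<lambda>z. - Re z) y) + \<i> * (P Im y - P (\<lambda>z. - Im z) y))"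
      by (auto simp: P_def complex_eq_iff max_def)
    then have "\<mu> h = \<mu> (\<lambda>y. (P Re y - P (\<lambda>z. - Re z) y) + \<i> * (P Im y - P (\<lambda>z. - Im z) y))"
      by simp
    also have "\<dots> = 0"
      using Ps cs D
      by (simp add: radon_add[OF \<mu>] radon_cmult[OF \<mu>] Cc_cmult[OF Hausdorff] radon_diff[OF Hausdorff \<mu>])
    finally show ?thesis .
  qed
  then show False using haar by (auto simp: left_haar_measure_def)
qed

text \<open>Both sides, multiplied by \<open>\<mu> w\<close>, are iterated integrals of \<open>w x * f (inv y \<otimes> x)\<close>.\<close>

lemma haar_inverse:
  assumes haar: "left_haar_measure G T \<mu>" and modular: "modular_function G T \<mu> \<Delta>" and f: "f \<in> Cc T"
  shows "\<mu> (\<lambda>x. f (inv x)) = \<mu> (\<lambda>x. f x * complex_of_real (inverse (\<Delta> x)))"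
proof -
  have \<mu>: "radon_measure T \<mu>"
    and li: "\<And>f x. f \<in> Cc T \<Longrightarrow> x \<in> carrier G \<Longrightarrow> \<mu> (\<lambda>g. f (x \<otimes> g)) = \<mu> f"
    using haar by (auto simp: left_haar_measure_def topspace_eq_carrier)
  have ri: "\<And>f x. f \<in> Cc T \<Longrightarrow> x \<in> carrier G \<Longrightarrow>
      \<mu> (\<lambda>g. f (g \<otimes> x)) = complex_of_real (inverse (\<Delta> x)) * \<mu> f"
    using modular by (auto simp: modular_function_def)
  obtain w where w: "w \<in> Cc T" "\<mu> w \<noteq> 0"
    using haar by (auto simp: left_haar_measure_def)
  define A where "A = fun_supp T w"
  define B where "B = fun_supp T f"
  have AB: "compactin T A" "compactin T B" using CcD(2) w f by (auto simp: A_def B_def)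
  have inA: "x \<in> A" if "x \<in> carrier G" "w x \<noteq> 0" for x
    unfolding A_def using that by (intro in_fun_supp) (auto simp: topspace_eq_carrier)
  have inB: "x \<in> B" if "x \<in> carrier G" "f x \<noteq> 0" for x
    unfolding B_def using that by (intro in_fun_supp) (auto simp: topspace_eq_carrier)
  have c1: "continuous_map (prod_topology T T) T fst" and c2: "continuous_map (prod_topology T T) T snd"
    by (auto intro: continuous_map_fst continuous_map_snd)
  note cw = continuous_map_compose'[OF CcD(1)[OF w(1)]] and cf = continuous_map_compose'[OF CcD(1)[OF f]]
  have F1c: "continuous_map (prod_topology T T) euclidean (\<lambda>(x, y). w x * f (inv y \<otimes> x))"
    unfolding case_prod_unfold
    by (intro continuous_map_mult cw cf continuous_map_group_mult continuous_map_group_inv c1 c2)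
  have F2c: "continuous_map (prod_topology T T) euclidean (\<lambda>(y, x). w (y \<otimes> x) * f x)"
    unfolding case_prod_unfold
    by (intro continuous_map_mult cw cf continuous_map_group_mult continuous_map_group_inv c1 c2)
  \<comment> \<open>Since \<open>y = (y \<otimes> x) \<otimes> inv x\<close>, this compact set
    contains every \<open>y\<close> at which either of the two kernels below is nonzero.\<close>
  define L where "L = A <#> m_inv G ` B"
  have L: "compactin T L"
    unfolding L_def by (intro compactin_set_mult compactin_inv_image AB)
  have LI: "y \<in> L" if "x \<in> carrier G" "y \<in> carrier G" "y \<otimes> x \<in> A" "x \<in> B" for x y
  proof -
    have "y = (y \<otimes> x) \<otimes> inv x" using that by (simp add: m_assoc)
    then show ?thesis using that unfolding L_def set_mult_def by blast
  qed
  have F1s: "x \<in> A \<and> y \<in> L" if "x \<in> topspace T" "y \<in> topspace T" "w x * f (inv y \<otimes> x) \<noteq> 0" for x y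
  proof -
    have xy: "x \<in> carrier G" "y \<in> carrier G" using that by (auto simp: topspace_eq_carrier)
    have "y \<otimes> (inv y \<otimes> x) = x" using xy by (simp flip: m_assoc)
    then show ?thesis using LI[of "inv y \<otimes> x" y] inA[of x] inB[of "inv y \<otimes> x"] xy that(3) by auto
  qed
  have F2s: "y \<in> L \<and> x \<in> B" if "y \<in> topspace T" "x \<in> topspace T" "w (y \<otimes> x) * f x \<noteq> 0" for x y
    using LI[of x y] inA[of "y \<otimes> x"] inB[of x] that by (auto simp: topspace_eq_carrier)
  have "\<mu> w * \<mu> (\<lambda>y. f (inv y)) = \<mu> (\<lambda>x. w x * \<mu> (\<lambda>y. f (inv y)))"
    using radon_multc[OF \<mu> w(1)] by simp
  \<comment> \<open>For fixed \<open>x\<close>, left invariance replaces \<open>y\<close> by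
    \<open>inv x \<otimes> y\<close>, whose inverse is \<open>inv y \<otimes> x\<close>.\<close>
  also have "\<dots> = \<mu> (\<lambda>x. \<mu> (\<lambda>y. w x * f (inv y \<otimes> x)))"
  proof (rule radon_cong[OF Hausdorff \<mu> Cc_multc[OF Hausdorff w(1)]])
    fix x assume "x \<in> topspace T"
    then have x: "x \<in> carrier G" by (simp add: topspace_eq_carrier)
    have "\<mu> (\<lambda>y. f (inv y)) = \<mu> (\<lambda>y. f (inv (inv x \<otimes> y)))"
      using li[OF Cc_inv[OF f], of "inv x"] x by simp
    also have "\<dots> = \<mu> (\<lambda>y. f (inv y \<otimes> x))"
      using x by (intro radon_cong[OF Hausdorff \<mu> Cc_lmult[OF Cc_inv[OF f]]])
        (auto simp: topspace_eq_carrier inv_mult_group)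
    finally have "w x * \<mu> (\<lambda>y. f (inv y)) = w x * \<mu> (\<lambda>y. f (inv y \<otimes> x))" by simp
    then show "w x * \<mu> (\<lambda>y. f (inv y)) = \<mu> (\<lambda>y. w x * f (inv y \<otimes> x))"
      using radon_cmult[OF \<mu> Cc_inv[OF Cc_rmult[OF f x]]] by simp
  qed
  also have "\<dots> = \<mu> (\<lambda>y. \<mu> (\<lambda>x. w x * f (inv y \<otimes> x)))"
    by (rule radon_Fubini[OF Hausdorff locally_compact Hausdorff \<mu> \<mu> F1c AB(1) L F1s])
  also have "\<dots> = \<mu> (\<lambda>y. \<mu> (\<lambda>x. w (y \<otimes> x) * f x))"
  proof (rule sym, rule radon_cong[OF Hausdorff \<mu> Cc_integral[OF Hausdorff Hausdorff \<mu> F2c L AB(2) F2s]])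
    fix y assume "y \<in> topspace T"
    then have y: "y \<in> carrier G" by (simp add: topspace_eq_carrier)
    have c: "(\<lambda>x. w x * f (inv y \<otimes> x)) \<in> Cc T"
      by (intro Cc_mult_right[OF Hausdorff _ w(1)] CcD(1) Cc_lmult[OF f] inv_closed y)
    have "\<mu> (\<lambda>x. w x * f (inv y \<otimes> x)) = \<mu> (\<lambda>x. w (y \<otimes> x) * f (inv y \<otimes> (y \<otimes> x)))"
      using li[OF c y] by simp
    also have "\<dots> = \<mu> (\<lambda>x. w (y \<otimes> x) * f x)"
      using y by (intro radon_cong[OF Hausdorff \<mu> Cc_lmult[OF c y]])
        (auto simp: topspace_eq_carrier simp flip: m_assoc)
    finally show "\<mu> (\<lambda>x. w (y \<otimes> x) * f x) = \<mu> (\<lambda>x. w x * f (inv y \<otimes> x))" ..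
  qed
  also have "\<dots> = \<mu> (\<lambda>x. \<mu> (\<lambda>y. w (y \<otimes> x) * f x))"
    by (rule radon_Fubini[OF Hausdorff locally_compact Hausdorff \<mu> \<mu> F2c L AB(2) F2s])
  \<comment> \<open>The inner integral is now that of a right translate of \<open>w\<close>; this is
    where the modular function comes in.\<close>
  also have "\<dots> = \<mu> (\<lambda>x. \<mu> w * (f x * complex_of_real (inverse (\<Delta> x))))"
  proof (rule sym, rule radon_cong[OF Hausdorff \<mu>])
    have "continuous_map T euclidean (\<lambda>x. complex_of_real (inverse (\<Delta> x)))"
      using modular unfolding modular_function_def
      by (intro continuous_map_of_real continuous_map_real_inverse) (force simp: topspace_eq_carrier)+
    then show "(\<lambda>x. \<mu> w * (f x * complex_of_real (inverse (\<Delta> x)))) \<in> Cc T"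
      by (intro Cc_cmult[OF Hausdorff] Cc_mult_right[OF Hausdorff _ f])
    fix x assume "x \<in> topspace T"
    then have x: "x \<in> carrier G" by (simp add: topspace_eq_carrier)
    show "\<mu> w * (f x * complex_of_real (inverse (\<Delta> x))) = \<mu> (\<lambda>y. w (y \<otimes> x) * f x)"
      using radon_multc[OF \<mu> Cc_rmult[OF w(1) x]] ri[OF w(1) x] by simp
  qed
  also have "\<dots> = \<mu> w * \<mu> (\<lambda>x. f x * complex_of_real (inverse (\<Delta> x)))"
  proof (rule radon_cmult[OF \<mu>])
    have "continuous_map T euclidean (\<lambda>x. complex_of_real (inverse (\<Delta> x)))"
      using modular unfolding modular_function_def
      by (intro continuous_map_of_real continuous_map_real_inverse) (force simp: topspace_eq_carrier)+
    then show "(\<lambda>x. f x * complex_of_real (inverse (\<Delta> x))) \<in> Cc T"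
      by (intro Cc_mult_right[OF Hausdorff _ f])
  qed
  finally show ?thesis using w(2) by simp
qed

end

text \<open>If \<phi> were nonzero at a point of an open set on which the measure vanishes, a test
  function there would make \<phi> f nonnegative and not identically zero, contradicting
  \<open>haar_faithful\<close>.\<close>

lemma (in locally_compact_group) measure_supp_density:
  assumes haar: "left_haar_measure G T \<mu>" and \<phi>: "continuous_map T euclidean \<phi>"
  shows "measure_supp T (density_measure \<phi> \<mu>) = fun_supp T \<phi>"
proof -
  have \<mu>: "radon_measure T \<mu>" using haar by (simp add: left_haar_measure_def)
  have supp: "fun_supp T \<phi> \<subseteq> topspace T" by (simp add: fun_supp_def closure_of_subset_topspace)
  have "(GREATEST U. openin T U \<and> (\<forall>f\<in>Cc T. fun_supp T f \<subseteq> U \<longrightarrow> density_measure \<phi> \<mu> f = 0))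
    = topspace T - fun_supp T \<phi>"
  proof (rule Greatest_equality, intro conjI ballI impI)
    show "openin T (topspace T - fun_supp T \<phi>)"
      unfolding fun_supp_def by (intro openin_diff openin_topspace closedin_closure_of)
    fix f assume f: "f \<in> Cc T" "fun_supp T f \<subseteq> topspace T - fun_supp T \<phi>"
    have "(0::complex) = \<phi> x * f x" if "x \<in> topspace T" for x
      using in_fun_supp[OF that, of f] in_fun_supp[OF that, of \<phi>] f(2) by fastforce
    then show "density_measure \<phi> \<mu> f = 0"
      unfolding density_measure_def
      using radon_cong[OF Hausdorff \<mu> Cc_zero[OF Hausdorff], of "\<lambda>x. \<phi> x * f x"]
        radon_zero[OF Hausdorff \<mu>] by simp
  next
    fix V assume V: "openin T V \<and> (\<forall>f\<in>Cc T. fun_supp T f \<subseteq> V \<longrightarrow> density_measure \<phi> \<mu> f = 0)"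
    have "V \<inter> {x \<in> topspace T. \<phi> x \<noteq> 0} = {}"
    proof (rule ccontr)
      assume "V \<inter> {x \<in> topspace T. \<phi> x \<noteq> 0} \<noteq> {}"
      then obtain x where x: "x \<in> V" "x \<in> topspace T" "\<phi> x \<noteq> 0" by blast
      obtain b :: "'a \<Rightarrow> real" and C where b: "continuous_map T euclidean b" "\<And>y. b y \<ge> 0" "b x = 1"
        "compactin T C" "C \<subseteq> V" "\<And>y. y \<in> topspace T \<Longrightarrow> b y \<noteq> 0 \<Longrightarrow> y \<in> C"
        using bump_function[OF Hausdorff locally_compact _ x(1)] V by metis
      \<comment> \<open>The conjugate turns the complex density into the nonnegative integrand
        \<open>(cmod (\<phi> y))\<^sup>2 * b y\<close>, positive at \<open>x\<close>.\<close>
      define f where "f y = cnj (\<phi> y) * complex_of_real (b y)" for y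
      have f: "f \<in> Cc T"
      proof (rule CcI[OF Hausdorff _ b(4)])
        have "continuous_map T euclidean (\<lambda>y. cnj (\<phi> y))"
          using \<phi> by (simp add: continuous_map_atin tendsto_cnj)
        then show "continuous_map T euclidean f"
          unfolding f_def by (intro continuous_map_mult continuous_map_of_real b)
      qed (use b in \<open>auto simp: f_def\<close>)
      have "fun_supp T f \<subseteq> C"
        using b Hausdorff by (intro fun_supp_subset compactin_imp_closedin) (auto simp: f_def)
      then have "\<mu> (\<lambda>y. \<phi> y * f y) = 0"
        using V f b by (auto simp: density_measure_def)
      moreover have "\<mu> (\<lambda>y. \<phi> y * f y) \<noteq> 0"
      proof (rule haar_faithful[OF haar Cc_mult_left[OF Hausdorff \<phi> f], of x])
        have "\<phi> y * f y = complex_of_real ((cmod (\<phi> y))\<^sup>2 * b y)" for y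
          by (simp add: f_def complex_norm_square mult.assoc del: of_real_power)
        moreover have "(cmod (\<phi> y))\<^sup>2 * b y \<ge> 0" for y using b(2) by simp
        ultimately show "\<phi> y * f y \<in> \<real>\<^sub>\<ge>\<^sub>0" for y by (simp only: nonneg_Reals_of_real_iff)
      qed (use x b in \<open>auto simp: f_def topspace_eq_carrier\<close>)
      ultimately show False by contradiction
    qed
    then have "V \<inter> fun_supp T \<phi> = {}"
      using V by (simp add: fun_supp_def openin_Int_closure_of_eq_empty)
    then show "V \<subseteq> topspace T - fun_supp T \<phi>"
      using V openin_subset by blast
  qed
  then show ?thesis using supp by (auto simp: measure_supp_def)
qed

section \<open>Integration over a closed subgroup\<close>

text \<open>Closedness of \<open>H\<close> supplies local compactness. This makes the inversion
  formula applicable to \<open>H\<close> with its own Haar measure.\<close>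

lemma subgroup_locally_compact_group:
  fixes G :: "('a, 'm) monoid_scheme" (structure)
  assumes "locally_compact_group G T" "subgroup H G" "closedin T H"
  shows "locally_compact_group (G\<lparr>carrier := H\<rparr>) (subtopology T H)"
proof -
  interpret locally_compact_group G T by fact
  have HG: "H \<subseteq> carrier G" by (rule subgroup.subset[OF assms(2)])
  have grp: "group (G\<lparr>carrier := H\<rparr>)" by (rule subgroup.subgroup_is_group[OF assms(2) is_group])
  let ?S = "subtopology T H"
  have c: "continuous_map X T f" if "continuous_map X ?S f" for X and f :: "'b \<Rightarrow> 'a"
    by (rule continuous_map_into_fulltopology[OF that])
  show ?thesis
  proof (intro locally_compact_group.intro grp locally_compact_group_axioms.intro)
    show "topspace ?S = carrier (G\<lparr>carrier := H\<rparr>)"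
      using HG by (auto simp: topspace_eq_carrier)
    have "continuous_map (prod_topology ?S ?S) T (\<lambda>z. fst z \<otimes> snd z)"
      by (intro continuous_map_group_mult c[OF continuous_map_fst] c[OF continuous_map_snd])
    then show "continuous_map (prod_topology ?S ?S) ?S (\<lambda>(x, y). x \<otimes>\<^bsub>G\<lparr>carrier := H\<rparr>\<^esub> y)"
      using subgroup.m_closed[OF assms(2)]
      by (intro continuous_map_into_subtopology) (auto simp: case_prod_unfold)
    have "continuous_map ?S T (\<lambda>x. inv x)"
      using continuous_inv by (rule continuous_map_from_subtopology)
    then have "continuous_map ?S ?S (\<lambda>x. inv x)"
      using subgroup.m_inv_closed[OF assms(2)] by (intro continuous_map_into_subtopology) auto
    then show "continuous_map ?S ?S (\<lambda>x. inv\<^bsub>G\<lparr>carrier := H\<rparr>\<^esub> x)"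
      by (rule continuous_map_eq) (use assms(2) in auto)
    show "Hausdorff_space ?S" by (rule Hausdorff_space_subtopology[OF Hausdorff])
    show "locally_compact_space ?S" by (rule locally_compact_space_closed_subset[OF locally_compact assms(3)])
  qed
qed

locale closed_subgroup = locally_compact_group G T + subgroup H G
  for G :: "('a, 'm) monoid_scheme" (structure) and T :: "'a topology" and H :: "'a set" +
  assumes closed: "closedin T H"
begin

abbreviation "S \<equiv> subtopology T H"

sublocale sub: locally_compact_group "G\<lparr>carrier := H\<rparr>" S
  by (rule subgroup_locally_compact_group[OF locally_compact_group_axioms subgroup_axioms closed])

lemma inv_S [simp]: "h \<in> H \<Longrightarrow> inv\<^bsub>G\<lparr>carrier := H\<rparr>\<^esub> h = inv h"
  by (rule m_inv_consistent[OF subgroup_axioms])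

lemma continuous_map_S: "continuous_map T Y f \<Longrightarrow> continuous_map S Y f"
  by (rule continuous_map_from_subtopology)

lemma continuous_map_snd': "continuous_map (prod_topology T S) T snd"
  by (rule continuous_map_into_fulltopology[OF continuous_map_snd])

lemma compactin_S: "compactin T K \<Longrightarrow> compactin S (K \<inter> H)"
  using closed by (simp add: compactin_subtopology compact_Int_closedin)

section \<open>Kernels a(g) b(gh) r(h) on the product of G and H\<close>

lemma translate_Cc_S:
  assumes "f \<in> Cc T" "g \<in> carrier G" "continuous_map S euclidean r"
  shows "(\<lambda>h. f (g \<otimes> h) * r h) \<in> Cc S"
proof (rule CcI[OF sub.Hausdorff])
  have f: "(\<lambda>h. f (g \<otimes> h)) \<in> Cc T" by (rule Cc_lmult[OF assms(1,2)])
  show "continuous_map S euclidean (\<lambda>h. f (g \<otimes> h) * r h)"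
    by (intro continuous_map_mult assms(3) continuous_map_S CcD(1)[OF f])
  show "compactin S (fun_supp T (\<lambda>h. f (g \<otimes> h)) \<inter> H)"
    by (intro compactin_S CcD(2)[OF f])
  show "h \<in> fun_supp T (\<lambda>h. f (g \<otimes> h)) \<inter> H" if "h \<in> topspace S" "f (g \<otimes> h) * r h \<noteq> 0" for h
    using that mem_carrier by (auto intro!: in_fun_supp simp: topspace_eq_carrier)
qed

text \<open>These are the premises of \<open>Cc_integral\<close> and \<open>radon_Fubini\<close>.
  The compact set for \<open>h\<close> comes from h = g^-1 (gh); the weight \<open>r\<close> will be
  1 or the quotient of modular functions.\<close>

lemma
  assumes a: "a \<in> Cc T" and b: "b \<in> Cc T" and r: "continuous_map S euclidean r"
  shows continuous_kernel: "continuous_map (prod_topology T S) euclidean (\<lambda>(g, h). a g * (b (g \<otimes> h) * r h))"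
    and compactin_kernel: "compactin S ((m_inv G ` fun_supp T a <#> fun_supp T b) \<inter> H)"
    and supp_kernel: "\<And>g h. g \<in> topspace T \<Longrightarrow> h \<in> topspace S \<Longrightarrow> a g * (b (g \<otimes> h) * r h) \<noteq> 0 \<Longrightarrow>
      g \<in> fun_supp T a \<and> h \<in> (m_inv G ` fun_supp T a <#> fun_supp T b) \<inter> H"
proof -
  show "continuous_map (prod_topology T S) euclidean (\<lambda>(g, h). a g * (b (g \<otimes> h) * r h))"
    unfolding case_prod_unfold
    by (intro continuous_map_mult continuous_map_compose'[OF CcD(1)[OF a]]
        continuous_map_compose'[OF CcD(1)[OF b]] continuous_map_compose'[OF r]
        continuous_map_group_mult continuous_map_fst continuous_map_snd continuous_map_snd')
  show "compactin S ((m_inv G ` fun_supp T a <#> fun_supp T b) \<inter> H)"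
    by (intro compactin_S compactin_set_mult compactin_inv_image CcD(2) a b)
  fix g h assume gh: "g \<in> topspace T" "h \<in> topspace S" "a g * (b (g \<otimes> h) * r h) \<noteq> 0"
  then have "g \<in> carrier G" "h \<in> carrier G" using mem_carrier by (auto simp: topspace_eq_carrier)
  moreover have "g \<in> fun_supp T a" "g \<otimes> h \<in> fun_supp T b"
    using gh calculation by (auto intro!: in_fun_supp simp: topspace_eq_carrier)
  ultimately show "g \<in> fun_supp T a \<and> h \<in> (m_inv G ` fun_supp T a <#> fun_supp T b) \<inter> H"
    using gh(2) set_mult_inv_imageI by auto
qed

text \<open>The factor \<open>a\<close> provides the compact support: the integral over
  \<open>H\<close> alone need not have one as a function of \<open>g\<close>.\<close>

lemma Cc_kernel_integral:
  assumes dh: "radon_measure S dh" and a: "a \<in> Cc T" and b: "b \<in> Cc T"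
    and r: "continuous_map S euclidean r"
  shows "(\<lambda>g. a g * dh (\<lambda>h. b (g \<otimes> h) * r h)) \<in> Cc T"
proof (rule Cc_cong[OF Cc_integral[OF Hausdorff sub.Hausdorff dh continuous_kernel[OF a b r]
          CcD(2)[OF a] compactin_kernel[OF a b r] supp_kernel[OF a b r]]])
  show "dh (\<lambda>h. a g * (b (g \<otimes> h) * r h)) = a g * dh (\<lambda>h. b (g \<otimes> h) * r h)" if "g \<in> topspace T" for g
    using that by (intro radon_cmult[OF dh] translate_Cc_S b r) (simp add: topspace_eq_carrier)
qed

text \<open>Both sides are iterated integrals of \<nu>(g) \<phi>(g h^-1)
  \<open>inverse (\<Delta>\<^sub>G h)\<close>: integrating over \<open>g\<close> inside leads to the
  left side, over \<open>h\<close> inside to the right side.\<close>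

lemma iterated_integral_modular:
  assumes haar: "left_haar_measure G T dg" and haar': "left_haar_measure (G\<lparr>carrier := H\<rparr>) S dh"
    and modular: "modular_function G T dg \<Delta>\<^sub>G"
    and modular': "modular_function (G\<lparr>carrier := H\<rparr>) S dh \<Delta>\<^sub>H"
    and \<phi>: "\<phi> \<in> Cc T" and \<nu>: "\<nu> \<in> Cc T"
  shows "dg (\<lambda>g. \<phi> g * dh (\<lambda>h. \<nu> (g \<otimes> h)))
    = dg (\<lambda>g. \<nu> g * dh (\<lambda>h. \<phi> (g \<otimes> h) * complex_of_real (\<Delta>\<^sub>G h / \<Delta>\<^sub>H h)))"
proof -
  have dg: "radon_measure T dg" and dh: "radon_measure S dh"
    using haar haar' by (auto simp: left_haar_measure_def)
  have ri: "\<And>f x. f \<in> Cc T \<Longrightarrow> x \<in> carrier G \<Longrightarrow>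
      dg (\<lambda>g. f (g \<otimes> x)) = complex_of_real (inverse (\<Delta>\<^sub>G x)) * dg f"
    and pos: "\<And>x. x \<in> carrier G \<Longrightarrow> \<Delta>\<^sub>G x > 0"
    and mult: "\<And>x y. x \<in> carrier G \<Longrightarrow> y \<in> carrier G \<Longrightarrow> \<Delta>\<^sub>G (x \<otimes> y) = \<Delta>\<^sub>G x * \<Delta>\<^sub>G y"
    and cont: "continuous_map T euclidean \<Delta>\<^sub>G"
    using modular by (auto simp: modular_function_def)
  have pos': "\<And>x. x \<in> H \<Longrightarrow> \<Delta>\<^sub>H x > 0" and cont': "continuous_map S euclidean \<Delta>\<^sub>H"
    using modular' by (auto simp: modular_function_def)
  have "\<Delta>\<^sub>G \<one> = 1" using mult[of \<one> \<one>] pos[of \<one>] by simp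
  then have \<Delta>_inv: "\<Delta>\<^sub>G (inv x) = inverse (\<Delta>\<^sub>G x)" if "x \<in> carrier G" for x
    using mult[of "inv x" x] that by (simp add: inverse_eq_divide) (metis inverse_unique inverse_eq_divide mult.commute)
  define q where "q h = complex_of_real (inverse (\<Delta>\<^sub>G h))" for h
  have q: "continuous_map S euclidean q"
    unfolding q_def using pos
    by (intro continuous_map_S continuous_map_of_real continuous_map_real_inverse cont)
      (force simp: topspace_eq_carrier)
  have one: "continuous_map S euclidean (\<lambda>_. 1::complex)" by simp
  define F where "F g h = \<nu> g * (\<phi> (g \<otimes> inv h) * q h)" for g h
  have Fc: "continuous_map (prod_topology T S) euclidean (\<lambda>(g, h). F g h)"
    unfolding F_def case_prod_unfold
    by (intro continuous_map_mult continuous_map_compose'[OF CcD(1)[OF \<nu>]]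
        continuous_map_compose'[OF CcD(1)[OF \<phi>]] continuous_map_compose'[OF q]
        continuous_map_group_mult continuous_map_group_inv continuous_map_fst continuous_map_snd continuous_map_snd')
  \<comment> \<open>The substitution in \<open>g\<close> leaves the range of \<open>h\<close>
    unchanged, so the compact set of the original kernel also serves for \<open>F\<close>.\<close>
  define L where "L = (m_inv G ` fun_supp T \<phi> <#> fun_supp T \<nu>) \<inter> H"
  have L: "compactin S L" unfolding L_def by (rule compactin_kernel[OF \<phi> \<nu> one])
  have Fs: "g \<in> fun_supp T \<nu> \<and> h \<in> L" if "g \<in> topspace T" "h \<in> topspace S" "F g h \<noteq> 0" for g h
  proof -
    have gh: "g \<in> carrier G" "h \<in> carrier G" "h \<in> H"
      using that mem_carrier by (auto simp: topspace_eq_carrier)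
    have "g \<in> fun_supp T \<nu>" "g \<otimes> inv h \<in> fun_supp T \<phi>"
      using that gh by (auto simp: F_def topspace_eq_carrier intro!: in_fun_supp)
    moreover have "(g \<otimes> inv h) \<otimes> h = g" using gh by (simp add: m_assoc)
    ultimately show ?thesis
      using set_mult_inv_imageI[of "g \<otimes> inv h" h] gh by (auto simp: L_def)
  qed
  have "dg (\<lambda>g. \<phi> g * dh (\<lambda>h. \<nu> (g \<otimes> h))) = dg (\<lambda>g. dh (\<lambda>h. \<phi> g * (\<nu> (g \<otimes> h) * 1)))"
  proof (rule radon_cong[OF Hausdorff dg])
    show "(\<lambda>g. \<phi> g * dh (\<lambda>h. \<nu> (g \<otimes> h))) \<in> Cc T"
      using Cc_kernel_integral[OF dh \<phi> \<nu> one] by simp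
    show "\<phi> g * dh (\<lambda>h. \<nu> (g \<otimes> h)) = dh (\<lambda>h. \<phi> g * (\<nu> (g \<otimes> h) * 1))" if "g \<in> topspace T" for g
      using radon_cmult[OF dh translate_Cc_S[OF \<nu> _ one], of g] that by (simp add: topspace_eq_carrier)
  qed
  also have "\<dots> = dh (\<lambda>h. dg (\<lambda>g. \<phi> g * (\<nu> (g \<otimes> h) * 1)))"
    by (rule radon_Fubini[OF Hausdorff locally_compact sub.Hausdorff dg dh continuous_kernel[OF \<phi> \<nu> one]
          CcD(2)[OF \<phi>] compactin_kernel[OF \<phi> \<nu> one] supp_kernel[OF \<phi> \<nu> one]])
  also have "\<dots> = dh (\<lambda>h. dg (\<lambda>g. F g h))"
  proof (rule sym, rule radon_cong[OF sub.Hausdorff dh])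
    have "continuous_map (prod_topology S T) euclidean (\<lambda>(h, g). F g h)"
      using continuous_map_compose'[OF Fc continuous_map_pairedI[OF continuous_map_snd continuous_map_fst]]
      by (simp add: case_prod_unfold)
    then show "(\<lambda>h. dg (\<lambda>g. F g h)) \<in> Cc S"
      using Fs by (intro Cc_integral[OF sub.Hausdorff Hausdorff dg _ L CcD(2)[OF \<nu>]]) auto
    fix h assume "h \<in> topspace S"
    then have h: "h \<in> carrier G" by (simp add: mem_carrier)
    have k: "(\<lambda>g. \<phi> (g \<otimes> inv h) * \<nu> g) \<in> Cc T"
      by (intro Cc_mult_left[OF Hausdorff _ \<nu>] CcD(1) Cc_rmult[OF \<phi>] inv_closed h)
    have "dg (\<lambda>g. F g h) = dg (\<lambda>g. q h * (\<phi> (g \<otimes> inv h) * \<nu> g))"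
      by (simp add: F_def mult.commute mult.left_commute)
    also have "\<dots> = q h * dg (\<lambda>g. \<phi> (g \<otimes> inv h) * \<nu> g)"
      by (rule radon_cmult[OF dg k])
    also have "\<dots> = dg (\<lambda>g. \<phi> ((g \<otimes> h) \<otimes> inv h) * \<nu> (g \<otimes> h))"
      using ri[OF k h] by (simp add: q_def)
    also have "\<dots> = dg (\<lambda>g. \<phi> g * (\<nu> (g \<otimes> h) * 1))"
      using h by (intro radon_cong[OF Hausdorff dg Cc_rmult[OF k h]]) (auto simp: topspace_eq_carrier m_assoc)
    finally show "dg (\<lambda>g. F g h) = dg (\<lambda>g. \<phi> g * (\<nu> (g \<otimes> h) * 1))" .
  qed
  also have "\<dots> = dg (\<lambda>g. dh (\<lambda>h. F g h))"
    by (rule sym, rule radon_Fubini[OF Hausdorff locally_compact sub.Hausdorff dg dh Fc CcD(2)[OF \<nu>] L Fs])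
  also have "\<dots> = dg (\<lambda>g. \<nu> g * dh (\<lambda>h. \<phi> (g \<otimes> h) * complex_of_real (\<Delta>\<^sub>G h / \<Delta>\<^sub>H h)))"
  proof (rule radon_cong[OF Hausdorff dg])
    show "(\<lambda>g. dh (F g)) \<in> Cc T"
      by (rule Cc_integral[OF Hausdorff sub.Hausdorff dh Fc CcD(2)[OF \<nu>] L Fs])
    fix g assume "g \<in> topspace T"
    then have g: "g \<in> carrier G" by (simp add: topspace_eq_carrier)
    \<comment> \<open>Chosen so that \<open>p\<close> at the inverse of \<open>h\<close> is the
      \<open>h\<close>-dependent part of \<open>F g h\<close>, by multiplicativity of
      \<open>\<Delta>\<^sub>G\<close>.\<close>
    define p where "p h = \<phi> (g \<otimes> h) * complex_of_real (\<Delta>\<^sub>G h)" for h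
    have p: "p \<in> Cc S"
      unfolding p_def by (intro translate_Cc_S \<phi> g continuous_map_of_real continuous_map_S cont)
    have pinv: "(\<lambda>h. p (inv\<^bsub>G\<lparr>carrier := H\<rparr>\<^esub> h)) \<in> Cc S" by (rule sub.Cc_inv[OF p])
    have eq: "p (inv\<^bsub>G\<lparr>carrier := H\<rparr>\<^esub> h) = \<phi> (g \<otimes> inv h) * q h" if "h \<in> H" for h
      using that mem_carrier[OF that] by (simp add: p_def q_def \<Delta>_inv)
    have "dh (F g) = \<nu> g * dh (\<lambda>h. \<phi> (g \<otimes> inv h) * q h)"
      unfolding F_def by (rule radon_cmult[OF dh Cc_cong[OF pinv]]) (use eq in auto)
    also have "dh (\<lambda>h. \<phi> (g \<otimes> inv h) * q h) = dh (\<lambda>h. p (inv\<^bsub>G\<lparr>carrier := H\<rparr>\<^esub> h))"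
      by (rule sym, rule radon_cong[OF sub.Hausdorff dh pinv]) (use eq in auto)
    also have "\<dots> = dh (\<lambda>h. p h * complex_of_real (inverse (\<Delta>\<^sub>H h)))"
      by (rule sub.haar_inverse[OF haar' modular' p])
    also have "\<dots> = dh (\<lambda>h. \<phi> (g \<otimes> h) * complex_of_real (\<Delta>\<^sub>G h / \<Delta>\<^sub>H h))"
      by (simp add: p_def divide_inverse mult.assoc)
    finally show "dh (F g) = \<nu> g * dh (\<lambda>h. \<phi> (g \<otimes> h) * complex_of_real (\<Delta>\<^sub>G h / \<Delta>\<^sub>H h))" .
  qed
  finally show ?thesis .
qed

section \<open>Functions on the coset space\<close>

lemma lcoset_eq_iff:
  assumes "g \<in> carrier G" "g' \<in> carrier G"
  shows "g <# H = g' <# H \<longleftrightarrow> (\<exists>h\<in>H. g' = g \<otimes> h)"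
proof
  assume "g <# H = g' <# H"
  then have "g' \<in> g <# H" using lcos_self[OF assms(2) subgroup_axioms] by simp
  then show "\<exists>h\<in>H. g' = g \<otimes> h" by (auto simp: l_coset_def)
next
  assume "\<exists>h\<in>H. g' = g \<otimes> h"
  then obtain h where h: "h \<in> H" "g' = g \<otimes> h" by blast
  have "\<exists>k'\<in>H. g \<otimes> k = g \<otimes> h \<otimes> k'" if "k \<in> H" for k
    using that h assms mem_carrier by (intro bexI[of _ "inv h \<otimes> k"]) (auto simp: m_assoc simp flip: m_assoc[of h])
  moreover have "\<exists>k'\<in>H. g \<otimes> h \<otimes> k = g \<otimes> k'" if "k \<in> H" for k
    using that h assms mem_carrier by (intro bexI[of _ "h \<otimes> k"]) (auto simp: m_assoc)
  ultimately show "g <# H = g' <# H"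
    unfolding h(2) l_coset_def by blast
qed

text \<open>The chosen representative differs from \<open>g\<close> by a right factor in
  \<open>H\<close>, which left invariance of \<open>dh\<close> absorbs.\<close>

lemma on_cosets_integral:
  assumes haar': "left_haar_measure (G\<lparr>carrier := H\<rparr>) S dh" and \<nu>: "\<nu> \<in> Cc T" and g: "g \<in> carrier G"
  shows "on_cosets G H (\<lambda>g. dh (\<lambda>h. \<nu> (g \<otimes> h))) (g <# H) = dh (\<lambda>h. \<nu> (g \<otimes> h))"
proof -
  have dh: "radon_measure S dh"
    and li: "\<And>f x. f \<in> Cc S \<Longrightarrow> x \<in> H \<Longrightarrow> dh (\<lambda>g. f (x \<otimes> g)) = dh f"
    using haar' by (auto simp: left_haar_measure_def)
  define g' where "g' = (SOME g'. g' \<in> carrier G \<and> g' <# H = g <# H)"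
  have "g' \<in> carrier G \<and> g' <# H = g <# H"
    unfolding g'_def by (rule someI[of _ g]) (use g in simp)
  then have g': "g' \<in> carrier G" "g <# H = g' <# H" by auto
  obtain h where h: "h \<in> H" "g' = g \<otimes> h" using g'(2) lcoset_eq_iff[OF g g'(1)] by blast
  have \<nu>g: "(\<lambda>h. \<nu> (g \<otimes> h)) \<in> Cc S"
    using translate_Cc_S[OF \<nu> g, of "\<lambda>_. 1"] by simp
  have \<nu>g': "(\<lambda>k. \<nu> (g' \<otimes> k)) \<in> Cc S"
    using translate_Cc_S[OF \<nu> g'(1), of "\<lambda>_. 1"] by simp
  have "dh (\<lambda>k. \<nu> (g' \<otimes> k)) = dh (\<lambda>k. \<nu> (g \<otimes> (h \<otimes> k)))"
    using h g mem_carrier by (intro radon_cong[OF sub.Hausdorff dh \<nu>g']) (simp add: m_assoc)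
  also have "\<dots> = dh (\<lambda>h. \<nu> (g \<otimes> h))" by (rule li[OF \<nu>g h(1)])
  finally show ?thesis by (simp add: on_cosets_def flip: g'_def)
qed

end

section \<open>Reduction to a density of compact support\<close>

theorem theorem1p4:
  fixes G :: "('a, 'm) monoid_scheme" and T :: "'a topology" and H :: "'a set"
    and dg dh :: "('a \<Rightarrow> complex) \<Rightarrow> complex"
    and \<Delta>\<^sub>G \<Delta>\<^sub>H :: "'a \<Rightarrow> real"
    and \<phi> \<nu> :: "'a \<Rightarrow> complex"
  assumes "locally_compact_group G T"
    and "subgroup H G" and "closedin T H"
    and "left_haar_measure G T dg"
    and "left_haar_measure (G\<lparr>carrier := H\<rparr>) (subtopology T H) dh"
    and "modular_function G T dg \<Delta>\<^sub>G"
    and "modular_function (G\<lparr>carrier := H\<rparr>) (subtopology T H) dh \<Delta>\<^sub>H"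
    and "continuous_map T euclidean \<phi>"
    and "proper_continuous_map (subtopology T (fun_supp T \<phi>)) (coset_topology G T H) (\<lambda>g. g <#\<^bsub>G\<^esub> H)"
    and "\<nu> \<in> Cc T"
  shows "pushforward T (\<lambda>g. g <#\<^bsub>G\<^esub> H) (density_measure \<phi> dg)
           (on_cosets G H (\<lambda>g. dh (\<lambda>h. \<nu> (g \<otimes>\<^bsub>G\<^esub> h))))
         = dg (\<lambda>g. \<nu> g * dh (\<lambda>h. \<phi> (g \<otimes>\<^bsub>G\<^esub> h) * complex_of_real (\<Delta>\<^sub>G h / \<Delta>\<^sub>H h)))"
proof -
  note haar = assms(4) and haar' = assms(5) and modular = assms(6) and modular' = assms(7)
    and \<phi> = assms(8) and proper = assms(9) and \<nu> = assms(10)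
  interpret closed_subgroup G T H
    by (intro closed_subgroup.intro closed_subgroup_axioms.intro assms)
  have dg: "radon_measure T dg" and dh: "radon_measure S dh"
    using haar haar' by (auto simp: left_haar_measure_def)
  let ?p = "\<lambda>g. g <#\<^bsub>G\<^esub> H"
  define F where "F g = dh (\<lambda>h. \<nu> (g \<otimes>\<^bsub>G\<^esub> h))" for g
  define r where "r h = complex_of_real (\<Delta>\<^sub>G h / \<Delta>\<^sub>H h)" for h
  have r: "continuous_map S euclidean r"
    unfolding r_def
  proof (intro continuous_map_of_real continuous_map_real_divide)
    show "continuous_map S euclidean \<Delta>\<^sub>G" "continuous_map S euclidean \<Delta>\<^sub>H"
      using modular modular' by (simp_all add: modular_function_def continuous_map_S)
    show "\<Delta>\<^sub>H h \<noteq> 0" if "h \<in> topspace S" for h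
      using modular' that by (fastforce simp: modular_function_def)
  qed
  \<comment> \<open>The preimage in \<open>supp \<phi>\<close> of a compact set of cosets, so
    properness applies.\<close>
  define K where "K = {g \<in> fun_supp T \<phi>. ?p g \<in> ?p ` fun_supp T \<nu>}"
  have supp: "fun_supp T \<phi> \<subseteq> carrier G"
    by (simp add: fun_supp_def closure_of_subset_topspace flip: topspace_eq_carrier)
  have "continuous_map T (coset_topology G T H) ?p"
    using quotient_map_coset_topology[OF topspace_eq_carrier] by (rule quotient_imp_continuous_map)
  then have "compactin (coset_topology G T H) (?p ` fun_supp T \<nu>)"
    using image_compactin[OF CcD(2)[OF \<nu>]] by blast
  then have "compactin (subtopology T (fun_supp T \<phi>))
      {g \<in> topspace (subtopology T (fun_supp T \<phi>)). ?p g \<in> ?p ` fun_supp T \<nu>}"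
    using proper unfolding proper_continuous_map_def by blast
  moreover have "{g \<in> topspace (subtopology T (fun_supp T \<phi>)). ?p g \<in> ?p ` fun_supp T \<nu>} = K"
    using supp by (auto simp: K_def topspace_eq_carrier)
  ultimately have K: "compactin T K" by (simp add: compactin_subtopology)
  obtain \<theta> where \<theta>: "\<theta> \<in> Cc T" "\<And>g. g \<in> K \<Longrightarrow> \<theta> g = 1"
    using Urysohn_Cc[OF Hausdorff locally_compact K] by blast
  \<comment> \<open>The first alternative is used for the inner integral of \<nu> on the left side,
    the second for the values \<phi>(gh) on the right side.\<close>
  have inK: "g \<in> K" if "g \<in> fun_supp T \<phi>" "g' \<in> fun_supp T \<nu>" "h \<in> H" "g' = g \<otimes>\<^bsub>G\<^esub> h \<or> g = g' \<otimes>\<^bsub>G\<^esub> h" for g g' h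
  proof -
    have "g \<in> carrier G" "g' \<in> carrier G"
      using that supp compactin_subset_topspace[OF CcD(2)[OF \<nu>]] by (auto simp: topspace_eq_carrier)
    then have "?p g = ?p g'" using that(3,4) lcoset_eq_iff by metis
    then show ?thesis using that(1,2) by (auto simp: K_def)
  qed
  have F0: "F g = 0" if g: "g \<in> fun_supp T \<phi>" "g \<notin> K" for g
  proof -
    have "0 = \<nu> (g \<otimes>\<^bsub>G\<^esub> h)" if h: "h \<in> H" for h
    proof (rule ccontr)
      assume "0 \<noteq> \<nu> (g \<otimes>\<^bsub>G\<^esub> h)"
      then have "g \<otimes>\<^bsub>G\<^esub> h \<in> fun_supp T \<nu>"
        using g h supp mem_carrier by (intro in_fun_supp) (auto simp: topspace_eq_carrier)
      then show False using inK[OF g(1) _ h] g(2) by blast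
    qed
    then have "dh (\<lambda>h. 0) = F g"
      unfolding F_def by (intro radon_cong[OF sub.Hausdorff dh Cc_zero[OF sub.Hausdorff]]) simp
    then show ?thesis using radon_zero[OF sub.Hausdorff dh] by simp
  qed
  define \<phi>' where "\<phi>' g = \<phi> g * \<theta> g" for g
  have \<phi>': "\<phi>' \<in> Cc T" unfolding \<phi>'_def by (rule Cc_mult_left[OF Hausdorff \<phi> \<theta>(1)])
  have F_Cc: "(\<lambda>g. a g * F g) \<in> Cc T" if "a \<in> Cc T" for a
    using Cc_kernel_integral[OF dh that \<nu>, of "\<lambda>_. 1"] by (simp add: F_def)
  have ms: "measure_supp T (density_measure \<phi> dg) = fun_supp T \<phi>"
    by (rule measure_supp_density[OF haar \<phi>])
  let ?P = "\<lambda>\<alpha>. \<alpha> \<in> Cc T \<and> (\<forall>x\<in>fun_supp T \<phi>. \<alpha> x = on_cosets G H F (?p x))"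
  have oc: "on_cosets G H F (?p x) = F x" if "x \<in> fun_supp T \<phi>" for x
    unfolding F_def by (rule on_cosets_integral[OF haar' \<nu> subsetD[OF supp that]])
  define \<alpha> where "\<alpha> = (SOME \<alpha>. ?P \<alpha>)"
  have "?P \<alpha>"
    unfolding \<alpha>_def
  proof (rule someI[of ?P], intro conjI ballI)
    \<comment> \<open>A witness for the choice in \<open>pushforward\<close>: on
      \<open>supp \<phi>\<close> it equals \<open>F\<close>, because \<theta> is 1 on
      \<open>K\<close> and \<open>F\<close> vanishes off \<open>K\<close>.\<close>
    show "(\<lambda>g. \<theta> g * F g) \<in> Cc T" by (rule F_Cc[OF \<theta>(1)])
    show "\<theta> x * F x = on_cosets G H F (?p x)" if "x \<in> fun_supp T \<phi>" for x
      using \<theta>(2)[of x] F0[OF that] oc[OF that] by (cases "x \<in> K") auto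
  qed
  then have \<alpha>: "\<alpha> \<in> Cc T" "\<And>x. x \<in> fun_supp T \<phi> \<Longrightarrow> \<alpha> x = F x" using oc by auto
  have "pushforward T ?p (density_measure \<phi> dg) (on_cosets G H F) = dg (\<lambda>g. \<phi> g * \<alpha> g)"
    unfolding pushforward_def ms by (simp add: density_measure_def flip: \<alpha>_def)
  also have "\<dots> = dg (\<lambda>g. \<phi>' g * F g)"
  proof (rule radon_cong[OF Hausdorff dg Cc_mult_left[OF Hausdorff \<phi> \<alpha>(1)]])
    \<comment> \<open>The chosen \<alpha> is known only on \<open>supp \<phi>\<close>; elsewhere the
      factor \<phi> is 0.\<close>
    show "\<phi> g * \<alpha> g = \<phi>' g * F g" if "g \<in> topspace T" for g
    proof (cases "\<phi> g = 0")
      case False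
      then have "g \<in> fun_supp T \<phi>" using that by (intro in_fun_supp)
      then show ?thesis using \<theta>(2)[of g] F0[of g] \<alpha>(2)[of g] by (cases "g \<in> K") (auto simp: \<phi>'_def)
    qed (simp add: \<phi>'_def)
  qed
  also have "\<dots> = dg (\<lambda>g. \<nu> g * dh (\<lambda>h. \<phi>' (g \<otimes>\<^bsub>G\<^esub> h) * r h))"
    unfolding F_def r_def by (rule iterated_integral_modular[OF haar haar' modular modular' \<phi>' \<nu>])
  also have "\<dots> = dg (\<lambda>g. \<nu> g * dh (\<lambda>h. \<phi> (g \<otimes>\<^bsub>G\<^esub> h) * r h))"
  proof (rule radon_cong[OF Hausdorff dg Cc_kernel_integral[OF dh \<nu> \<phi>' r]])
    fix g assume g: "g \<in> topspace T"
    show "\<nu> g * dh (\<lambda>h. \<phi>' (g \<otimes>\<^bsub>G\<^esub> h) * r h) = \<nu> g * dh (\<lambda>h. \<phi> (g \<otimes>\<^bsub>G\<^esub> h) * r h)"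
    proof (cases "\<nu> g = 0")
      case False
      then have g\<nu>: "g \<in> fun_supp T \<nu>" using g by (intro in_fun_supp)
      have gc: "g \<in> carrier G" using g by (simp add: topspace_eq_carrier)
      have "\<phi>' (g \<otimes>\<^bsub>G\<^esub> h) = \<phi> (g \<otimes>\<^bsub>G\<^esub> h)" if h: "h \<in> H" for h
      proof (cases "\<phi> (g \<otimes>\<^bsub>G\<^esub> h) = 0")
        case False
        then have "g \<otimes>\<^bsub>G\<^esub> h \<in> fun_supp T \<phi>"
          using gc h mem_carrier by (intro in_fun_supp) (auto simp: topspace_eq_carrier)
        then have "g \<otimes>\<^bsub>G\<^esub> h \<in> K" using inK g\<nu> h by blast
        then show ?thesis by (simp add: \<phi>'_def \<theta>(2))
      qed (simp add: \<phi>'_def)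
      then have "dh (\<lambda>h. \<phi>' (g \<otimes>\<^bsub>G\<^esub> h) * r h) = dh (\<lambda>h. \<phi> (g \<otimes>\<^bsub>G\<^esub> h) * r h)"
        by (intro radon_cong[OF sub.Hausdorff dh translate_Cc_S[OF \<phi>' gc r]]) simp
      then show ?thesis by simp
    qed simp
  qed
  finally show ?thesis unfolding F_def r_def .
qed

end
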